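(* Let $q \in (0, \tfrac{1}{2})$ and $p = 1-q$. There is a constant $C_q$ depending only on $q$ such that for every $n \ge 2$ the following holds. Let $\mathbf{X} \in \{0,1\}^n$ be chosen uniformly at random, and let $N \le \exp(C_q \sqrt{\log n})$ be a suitable number of traces, where the traces $\widetilde{\mathbf{X}}_1, \ldots, \widetilde{\mathbf{X}}_N$ are, conditionally on $\mathbf{X}$, independent samples from $\mathcal{D}_p(\mathbf{X})$. Then there is a reconstruction procedure, i.e. a map $A_n$ sending the $N$ traces to a string in $\{0,1\}^n$, such that $\mathbb{P}\big(A_n(\widetilde{\mathbf{X}}_1, \ldots, \widetilde{\mathbf{X}}_N) = \mathbf{X}\big) \ge 1 - \frac{C_q}{n}$, where the probability is over both the choice of $\mathbf{X}$ and the randomness of the deletion channel.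
   Context: The deletion channel with deletion probability $q$ (retention probability $p = 1-q$) takes a bit string $\mathbf{x} \in \{0,1\}^n$, independently retains each bit with probability $p$ and deletes it with probability $q$, and outputs the concatenation of the retained bits (in their original order); such an output is called a trace. $\mathcal{D}_p(\mathbf{x})$ denotes the distribution of a trace of $\mathbf{x}$. *)

theory Defs
  imports "HOL-Probability.Probability"
begin

text \<open>
  A trace of \<open>x\<close>: each position gets an independent Bernoulli(\<open>p\<close>) mark, and exactly the bits
  marked \<^const>\<open>True\<close> are retained, in order. Here \<open>p\<close> is the retention probability; the definition
  is meant for \<open>0 \<le> p \<le> 1\<close> (\<^const>\<open>bernoulli_pmf\<close> truncates its parameter to that interval).
\<close>
definition trace_pmf :: "real \<Rightarrow> bool list \<Rightarrow> bool list pmf" where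
  "trace_pmf p x =
     map_pmf (\<lambda>marks. map fst (filter snd (zip x marks)))
       (replicate_pmf (length x) (bernoulli_pmf p))"

definition bit_strings :: "nat \<Rightarrow> bool list set" where
  "bit_strings n = {x. length x = n}"

text \<open>
  Joint law of the random string and its traces: the \<open>N\<close> traces are independent
  conditionally on the string, but not unconditionally.
\<close>
definition string_and_traces_pmf :: "real \<Rightarrow> nat \<Rightarrow> nat \<Rightarrow> (bool list \<times> bool list list) pmf" where
  "string_and_traces_pmf p n N =
     do {
       x \<leftarrow> pmf_of_set (bit_strings n);
       traces \<leftarrow> replicate_pmf N (trace_pmf p x);
       return_pmf (x, traces)
     }"

end

theory Submission
  imports Defs "HOL-Complex_Analysis.Conformal_Mappings"
begin

text \<open>
  Bit \<open>k\<close> is recovered from a candidate for the first \<open>k\<close> bits, as follows. Match a trace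
  greedily to the known bits up to a position \<open>k'\<close> about \<open>log n\<close> before \<open>k\<close>; the rest of the trace is
  then a trace of the string started at a random position \<open>k' + S\<close>, whose law depends on the
  known bits only. With \<open>z = q + p w\<close>, the generating function in \<open>w\<close> of the means of the
  remaining trace bits is \<open>p\<close> times the generating function in \<open>z\<close> of the string, shifted by \<open>S\<close>.
  For two strings that first differ at \<open>k\<close> the difference is therefore a product of
  the shift factor and a polynomial \<open>A\<close> with coefficients in \<open>{-1, 0, 1}\<close> and \<open>\<bar>A 0\<bar> = 1\<close>. On an arc
  of length \<open>1 / L\<close> near 1, with \<open>L = sqrt (log n)\<close>, some value of \<open>A\<close> is at least \<open>exp (- O(L))\<close>, and the
  shift factor is of order 1 provided that \<open>S\<close> is \<open>O(L)\<close> with probability close to 1.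
  For a uniform string and \<open>q < 1 / 2\<close> the lag of the greedy matching has exponential tails. Hence
  the probability that a given \<open>k'\<close> fails is \<open>exp (- c L)\<close>, and the probability that \<open>L\<close> well-spaced
  positions in a window of length \<open>O(log n)\<close> fail simultaneously is \<open>exp (- c L\<^sup>2)\<close>, a negative power of \<open>n\<close>.
\<close>

section \<open>A lower bound on a short arc\<close>

text \<open>The \<open>m\<close> rotates of a point of the unit circle are spaced by
  \<open>2 * pi / m\<close>, so the one nearest to 1 is at most half a spacing away;
  \<open>k\<close> rounds the number of rotations that would lead exactly to 1.\<close>

lemma cis_rotate_into_arc:
  assumes "m > 0"
  obtains j \<phi> where "j < m" "\<bar>\<phi>\<bar> \<le> pi / real m" "cis t * cis (2 * pi * real j / real m) = cis \<phi>"
proof -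
  define s where "s = - t * real m / (2 * pi)"
  define k where "k = round s"
  define j where "j = nat (k mod int m)"
  define \<phi> where "\<phi> = t + 2 * pi * real_of_int k / real m"
  have "\<bar>real_of_int k - s\<bar> \<le> 1 / 2"
    unfolding k_def using of_int_round_abs_le[of s] by simp
  moreover have "\<phi> = (2 * pi / real m) * (real_of_int k - s)"
    unfolding \<phi>_def s_def using assms by (simp add: field_simps)
  ultimately have "\<bar>\<phi>\<bar> \<le> (2 * pi / real m) * (1 / 2)"
    using assms by (simp only: abs_mult) (intro mult_mono, auto)
  then have \<phi>: "\<bar>\<phi>\<bar> \<le> pi / real m" by simp
  have jm: "j < m" "int j = k mod int m"
    unfolding j_def using assms by (auto simp: nat_less_iff)
  have "k = int j + int m * (k div int m)" using jm by simp
  then have k: "real_of_int k = real j + real m * real_of_int (k div int m)"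
    by (metis of_int_add of_int_mult of_int_of_nat_eq)
  have "\<phi> = t + 2 * pi * real j / real m + 2 * pi * real_of_int (k div int m)"
    unfolding \<phi>_def k using assms by (simp add: field_simps)
  then have "cis \<phi> = cis t * cis (2 * pi * real j / real m)"
    by (simp add: cis_multiple_2pi flip: cis_mult)
  with jm \<phi> show ?thesis using that by simp
qed

lemma norm_one_plus_sq:
  fixes v :: complex
  assumes "norm v = 1"
  shows "(norm (1 + v))\<^sup>2 = 4 - (norm (1 - v))\<^sup>2"
proof -
  have "(Re v)\<^sup>2 + (Im v)\<^sup>2 = 1" using assms cmod_power2[of v] by simp
  then show ?thesis unfolding cmod_power2 by (simp add: power2_sum power2_diff)
qed

text \<open>With \<open>d\<close> the squared distance from \<open>v\<close> to 1, this is
  \<open>sqrt (4 - d) \<le> 2 - d / 4\<close>. The map \<open>v * (1 + v) / 2\<close> touches the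
  unit circle only at 1, and there to second order.\<close>

lemma norm_one_plus_sphere:
  fixes v :: complex
  assumes "norm v = 1"
  shows "norm (v * (1 + v) / 2) \<le> 1 - (norm (1 - v))\<^sup>2 / 8"
proof -
  note eq = norm_one_plus_sq[OF assms]
  define d where "d = (norm (1 - v))\<^sup>2"
  have "(norm (1 + v))\<^sup>2 \<le> (2 - d / 4)\<^sup>2"
    unfolding eq d_def[symmetric] by (simp add: power2_diff)
  moreover have "0 \<le> 2 - d / 4"
    using eq zero_le_power2[of "norm (1 + v)"] unfolding d_def by linarith
  ultimately have "norm (1 + v) \<le> 2 - d / 4"
    by (rule power2_le_imp_le)
  moreover have "norm (v * (1 + v) / 2) = norm (1 + v) / 2"
    using assms by (simp add: norm_mult norm_divide)
  ultimately show ?thesis unfolding d_def by linarith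
qed

text \<open>The factor \<open>(1 - v)\<^sup>2\<close> makes \<open>f (r v (1 + v) / 2)\<close> bounded by 8 on the unit circle; the
  product over the \<open>m\<close> rotations of the result has modulus 1 at the origin, so by the maximum
  principle one of its factors is not small, and that factor can be taken on the arc.\<close>
lemma large_on_arc:
  fixes f :: "complex \<Rightarrow> complex"
  assumes hol: "f holomorphic_on ball 0 1"
    and bound: "\<And>z. norm z < 1 \<Longrightarrow> norm (f z) \<le> 1 / (1 - norm z)"
    and f0: "norm (f 0) = 1" and r: "0 \<le> r" "r < 1" and m: "m > 0"
  obtains \<phi> where "\<bar>\<phi>\<bar> \<le> pi / real m"
    "(1 / 8) ^ m \<le> norm (f (of_real r * (cis \<phi> * (1 + cis \<phi>) / 2)))"
proof -
  define \<psi> where "\<psi> v = of_real r * (v * (1 + v) / 2)" for v :: complex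
  define G where "G v = f (\<psi> v) * (1 - v)\<^sup>2" for v
  define \<omega> where "\<omega> j = cis (2 * pi * real j / real m)" for j
  define F where "F v = (\<Prod>j<m. G (v * \<omega> j))" for v
  have \<psi>_ball: "norm (\<psi> v) < 1" if "norm v \<le> 1" for v
  proof -
    have "norm (1 + v) \<le> 2" using norm_triangle_ineq[of 1 v] that by simp
    then have "norm v * norm (1 + v) \<le> 1 * 2" using that by (intro mult_mono) auto
    then have "norm (v * (1 + v) / 2) \<le> 1" by (simp add: norm_mult norm_divide)
    then have "norm (\<psi> v) \<le> r * 1" unfolding \<psi>_def norm_mult using r by (intro mult_mono) auto
    then show ?thesis using r by simp
  qed
  have norm_\<omega>: "norm (\<omega> j) = 1" for j unfolding \<omega>_def by simp
  have G8: "norm (G v) \<le> 8" if "norm v = 1" for v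
  proof -
    define d where "d = (norm (1 - v))\<^sup>2"
    have d0: "0 \<le> d" by (simp add: d_def)
    have "norm (\<psi> v) \<le> 1 * norm (v * (1 + v) / 2)"
      unfolding \<psi>_def norm_mult[of "of_real r"] using r by (intro mult_right_mono) auto
    also have "\<dots> \<le> 1 - d / 8" using norm_one_plus_sphere[OF that] by (simp add: d_def)
    finally have d8: "d \<le> 8 * (1 - norm (\<psi> v))" by simp
    have pos: "1 - norm (\<psi> v) > 0" using \<psi>_ball that by simp
    have "norm (f (\<psi> v)) * d \<le> 1 / (1 - norm (\<psi> v)) * d"
      using bound[OF \<psi>_ball] that d0 by (intro mult_right_mono) auto
    also have "\<dots> \<le> 8" using d8 pos by (simp add: divide_le_eq)
    finally show ?thesis unfolding G_def norm_mult norm_power d_def .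
  qed
  have G4: "norm (G v) \<le> 4 * norm (f (\<psi> v))" if "norm v = 1" for v
  proof -
    have "norm (1 - v) \<le> 2" using norm_triangle_ineq4[of 1 v] that by simp
    then have "(norm (1 - v))\<^sup>2 \<le> 2\<^sup>2" by (intro power_mono) auto
    then have "norm (f (\<psi> v)) * (norm (1 - v))\<^sup>2 \<le> norm (f (\<psi> v)) * 4" by (intro mult_left_mono) auto
    then show ?thesis unfolding G_def by (simp add: norm_mult norm_power)
  qed
  have "\<exists>\<phi>. \<bar>\<phi>\<bar> \<le> pi / real m \<and> (1 / 8) ^ m \<le> norm (f (\<psi> (cis \<phi>)))"
  proof (rule ccontr)
    assume "\<not> ?thesis"
    then have small: "norm (f (\<psi> (cis \<phi>))) < (1 / 8) ^ m" if "\<bar>\<phi>\<bar> \<le> pi / real m" for \<phi>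
      using that by force
    have le: "norm (F v) \<le> 1 / 2" if v: "norm v = 1" for v
    proof -
      have "v = cis (Arg v)" using rcis_cmod_Arg[of v] v by (simp add: rcis_def)
      then obtain t where t: "v = cis t" ..
      obtain j \<phi> where j: "j < m" "\<bar>\<phi>\<bar> \<le> pi / real m" "v * \<omega> j = cis \<phi>"
        using cis_rotate_into_arc[OF m, of t] unfolding t \<omega>_def by blast
      \<comment> \<open>One rotate lies on the arc and contributes at most
        \<open>4 * (1 / 8) ^ m\<close>, the other \<open>m - 1\<close> at most 8 each; the product
        stays below the value 1 at the origin.\<close>
      have "norm (F v) = norm (G (v * \<omega> j)) * (\<Prod>i\<in>{..<m} - {j}. norm (G (v * \<omega> i)))"
        unfolding F_def prod_norm[symmetric] using j by (intro prod.remove) auto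
      also have "\<dots> \<le> (4 * (1 / 8) ^ m) * (\<Prod>i\<in>{..<m} - {j}. 8)"
      proof (intro mult_mono prod_mono conjI)
        show "norm (G (v * \<omega> j)) \<le> 4 * (1 / 8) ^ m"
          using G4[of "v * \<omega> j"] small[OF j(2)] unfolding j(3) by simp
        show "norm (G (v * \<omega> i)) \<le> 8" for i using v by (intro G8) (simp add: norm_mult norm_\<omega>)
      qed (auto intro: prod_nonneg)
      also have "\<dots> = 4 * (1 / 8) ^ m * 8 ^ (m - 1)" using j by simp
      also have "\<dots> = 1 / 2"
        using m power_mult_distrib[of "1 / 8 :: real" 8 "m - 1"] by (cases m) simp_all
      finally show ?thesis .
    qed
    \<comment> \<open>Because \<open>r < 1\<close>, the closed disc is mapped into the open disc, so
      \<open>F\<close> is continuous up to the circle although \<open>f\<close> is only known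
      inside.\<close>
    have \<psi>_im: "(\<lambda>v. \<psi> (v * \<omega> j)) ` cball 0 1 \<subseteq> ball 0 1" for j
      using \<psi>_ball by (auto simp: norm_mult norm_\<omega>)
    have hol\<psi>: "(\<lambda>v. f (\<psi> (v * \<omega> j))) holomorphic_on ball 0 1" for j
    proof -
      have "(\<lambda>v. \<psi> (v * \<omega> j)) holomorphic_on ball 0 1"
        unfolding \<psi>_def by (intro holomorphic_intros) auto
      moreover have "(\<lambda>v. \<psi> (v * \<omega> j)) ` ball 0 1 \<subseteq> ball 0 1"
        using \<psi>_im[of j] ball_subset_cball[of 0 1] by blast
      ultimately have "(f \<circ> (\<lambda>v. \<psi> (v * \<omega> j))) holomorphic_on ball 0 1"
        by (rule holomorphic_on_compose_gen[OF _ hol])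
      then show ?thesis by (simp add: o_def)
    qed
    have cont\<psi>: "continuous_on (cball 0 1) (\<lambda>v. f (\<psi> (v * \<omega> j)))" for j
    proof (rule continuous_on_compose2[OF holomorphic_on_imp_continuous_on[OF hol] _ \<psi>_im])
      show "continuous_on (cball 0 1) (\<lambda>v. \<psi> (v * \<omega> j))"
        unfolding \<psi>_def by (intro continuous_intros) auto
    qed
    have "norm (F 0) \<le> 1 / 2"
    proof (rule maximum_modulus_frontier[of F "cball 0 1"])
      show "F holomorphic_on interior (cball 0 1)"
        unfolding F_def G_def interior_cball by (intro holomorphic_intros hol\<psi>)
      show "continuous_on (closure (cball 0 1)) F"
        unfolding F_def G_def closure_closed[OF closed_cball] by (intro continuous_intros cont\<psi>)
      show "norm (F z) \<le> 1 / 2" if "z \<in> frontier (cball 0 1)" for z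
        using that by (intro le) simp
    qed simp_all
    moreover have "norm (F 0) = 1"
      unfolding F_def G_def \<psi>_def by (simp add: f0 norm_power)
    ultimately show False by simp
  qed
  then obtain \<phi> where "\<bar>\<phi>\<bar> \<le> pi / real m" "(1 / 8) ^ m \<le> norm (f (\<psi> (cis \<phi>)))" by blast
  then show ?thesis unfolding \<psi>_def by (rule that)
qed

section \<open>The lag of the greedy matching\<close>

primrec bit_avg :: "nat \<Rightarrow> (bool list \<Rightarrow> real) \<Rightarrow> real" where
  "bit_avg 0 f = f []"
| "bit_avg (Suc n) f =
    (bit_avg n (\<lambda>x. f (True # x)) + bit_avg n (\<lambda>x. f (False # x))) / 2"

lemma bit_avg_add: "bit_avg n (\<lambda>x. f x + g x) = bit_avg n f + bit_avg n g"
  by (induction n arbitrary: f g) (auto simp: field_simps)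

lemma bit_avg_cmult: "bit_avg n (\<lambda>x. c * f x) = c * bit_avg n f"
  by (induction n arbitrary: f) (auto simp: field_simps)

lemma bit_avg_divide: "bit_avg n (\<lambda>x. f x / c) = bit_avg n f / c"
  using bit_avg_cmult[of n "1 / c" f] by simp

lemma bit_avg_const [simp]: "bit_avg n (\<lambda>x. c) = c"
  by (induction n) auto

lemma bit_avg_mono:
  "(\<And>x. length x = n \<Longrightarrow> f x \<le> g x) \<Longrightarrow> bit_avg n f \<le> bit_avg n g"
proof (induction n arbitrary: f g)
  case (Suc n)
  have "bit_avg n (\<lambda>x. f (b # x)) \<le> bit_avg n (\<lambda>x. g (b # x))" for b
    by (intro Suc.IH Suc.prems) simp
  then show ?case by (simp add: add_mono divide_right_mono)
qed auto

lemma bit_avg_cong: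
  "(\<And>x. length x = n \<Longrightarrow> f x = g x) \<Longrightarrow> bit_avg n f = bit_avg n g"
  by (intro antisym bit_avg_mono) auto

lemma bit_avg_append:
  "bit_avg (m + n) f = bit_avg m (\<lambda>x. bit_avg n (\<lambda>y. f (x @ y)))"
  by (induction m arbitrary: f) auto

lemma bit_avg_snoc:
  "bit_avg (Suc n) f = (bit_avg n (\<lambda>x. f (x @ [True])) + bit_avg n (\<lambda>x. f (x @ [False]))) / 2"
  using bit_avg_append[of n 1 f] by (simp add: bit_avg_divide bit_avg_add)

lemma bit_avg_Markov:
  assumes "\<And>x. length x = n \<Longrightarrow> 0 \<le> f x" "\<And>x. length x = n \<Longrightarrow> P x \<Longrightarrow> c \<le> f x" "0 < c"
  shows "bit_avg n (\<lambda>x. of_bool (P x)) \<le> bit_avg n f / c"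
  unfolding bit_avg_divide[symmetric]
proof (rule bit_avg_mono)
  fix x :: "bool list" assume "length x = n"
  then show "of_bool (P x) \<le> f x / c" using assms(1,2)[of x] assms(3) by (cases "P x") auto
qed

text \<open>One greedy step: \<open>a\<close> lists the bits still waiting, a retained bit
  \<open>b\<close> is matched to its first occurrence, and all bits before it are given up. Without
  an occurrence, all of \<open>a\<close> is given up.\<close>

definition consume :: "bool list \<Rightarrow> bool \<Rightarrow> bool list" where
  "consume a b = tl (dropWhile (\<lambda>c. c \<noteq> b) a)"

lemma consume_Nil [simp]: "consume [] b = []"
  by (simp add: consume_def)

lemma consume_Cons [simp]: "consume (c # a) b = (if c = b then a else consume a b)"
  by (simp add: consume_def)

lemma consume_append: "b \<in> set a \<Longrightarrow> consume (a @ a') b = consume a b @ a'"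
  by (induction a) auto

lemma consume_notin: "b \<notin> set a \<Longrightarrow> consume a b = []"
  by (induction a) auto

text \<open>If the bits waiting to be matched are uniform, they remain so after a retained bit is matched,
  conditionally on their number, and that number drops by a geometric amount.\<close>
lemma bit_avg_consume:
  defines "avg y f \<equiv> bit_avg y (\<lambda>a. (f (consume (a @ [True]) True) + f (consume (a @ [False]) False)) / 2)"
  shows "avg 0 f = f []"
    and "avg (Suc y) f = (bit_avg (Suc y) f + avg y f) / 2"
proof -
  show "avg 0 f = f []" by (simp add: avg_def)
  have "avg (Suc y) f = (bit_avg y (\<lambda>a. f (a @ [True])) + bit_avg y (\<lambda>a. f (a @ [False]))) / 4 + avg y f / 2"
    unfolding avg_def by (simp add: bit_avg_add bit_avg_divide field_simps)
  then show "avg (Suc y) f = (bit_avg (Suc y) f + avg y f) / 2"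
    unfolding bit_avg_snoc by (simp add: field_simps)
qed

section \<open>Drift of the lag under random deletions\<close>

locale deletion_channel =
  fixes p q :: real
  assumes q_pos: "0 < q" and q_half: "q < 1 / 2" and p_eq: "p = 1 - q"
begin

lemma p_bounds: "1 / 2 < p" "p < 1" "0 < p" "p \<le> 1" "0 \<le> p" "p + q = 1"
  using q_pos q_half p_eq by auto

text \<open>Expectation, over the deletions, of \<open>f\<close> applied to the part of the string that has
  been passed but not yet matched after \<open>x\<close> has been read, starting with \<open>a\<close> unmatched.\<close>
primrec run :: "(bool list \<Rightarrow> real) \<Rightarrow> bool list \<Rightarrow> bool list \<Rightarrow> real" where
  "run f a [] = f a"
| "run f a (b # x) = q * run f (a @ [b]) x + p * run f (consume (a @ [b]) b) x"


lemma run_append: "run f a (x @ y) = run (\<lambda>a'. run f a' y) a x"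
  by (induction x arbitrary: a) auto

lemma run_add: "run (\<lambda>a. f a + g a) a x = run f a x + run g a x"
  by (induction x arbitrary: a) (auto simp: algebra_simps)

lemma run_cmult: "run (\<lambda>a. c * f a) a x = c * run f a x"
  by (induction x arbitrary: a) (auto simp: algebra_simps)

lemma run_const [simp]: "run (\<lambda>a. c) a x = c"
proof (induction x arbitrary: a)
  case (Cons b x)
  have "q * c + p * c = (p + q) * c" by (simp add: algebra_simps)
  then show ?case using Cons p_bounds by simp
qed simp

lemma run_sum: "run (\<lambda>a. \<Sum>i\<in>A. f i a) a x = (\<Sum>i\<in>A. run (f i) a x)"
  by (induction A rule: infinite_finite_induct) (auto simp: run_add)

lemma run_mono:
  assumes "\<And>a. f a \<le> g a"
  shows "run f a x \<le> run g a x"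
  using p_bounds q_pos by (induction x arbitrary: a) (auto intro!: add_mono mult_left_mono assms)

lemma run_nonneg: "(\<And>a. 0 \<le> f a) \<Longrightarrow> 0 \<le> run f a x"
  using run_mono[of "\<lambda>_. 0" f a x] by simp

lemma run_bit_avg: "run (\<lambda>a. bit_avg n (f a)) a x = bit_avg n (\<lambda>y. run (\<lambda>a. f a y) a x)"
  by (induction x arbitrary: a) (simp_all add: bit_avg_add bit_avg_cmult)

text \<open>Jensen's inequality, applied at each step to the mixture with weights \<open>q\<close>
  and \<open>p\<close>.\<close>

lemma exp_run_le: "exp (run f a x) \<le> run (\<lambda>a. exp (f a)) a x"
proof (induction x arbitrary: a)
  case (Cons b x)
  let ?u = "run f (a @ [b]) x" and ?v = "run f (consume (a @ [b]) b) x"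
  have "convex_on UNIV (exp :: real \<Rightarrow> real)"
    by (rule exp_convex)
  then have "exp (q * ?u + p * ?v) \<le> q * exp ?u + p * exp ?v"
    using p_bounds q_pos unfolding convex_on_def by (force simp: add.commute)
  also have "\<dots> \<le> q * run (\<lambda>a. exp (f a)) (a @ [b]) x + p * run (\<lambda>a. exp (f a)) (consume (a @ [b]) b) x"
    using p_bounds q_pos Cons.IH by (intro add_mono mult_left_mono) auto
  finally show ?case by simp
qed simp

text \<open>The lag of the greedy alignment drifts downwards: \<open>growth\<close> raised to the lag contracts by
  the factor \<open>contraction\<close> at each step, up to an additive constant. Here
  \<open>growth / (2 * growth - 1)\<close> is the expectation of \<open>growth ^ (1 - G)\<close> for a fair geometric
  variable \<open>G \<ge> 1\<close>; the contraction requires \<open>1 < growth < 1 + (1 - 2 q) / (2 q)\<close>.\<close>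
definition growth :: real where "growth = 1 + (1 - 2 * q) / 2"

definition contraction :: real where
  "contraction = q * growth + p * (growth / (2 * growth - 1))"

text \<open>The sum of the geometric series of \<open>contraction\<close>; it bounds the additive
  errors accumulated over any number of steps.\<close>

definition offset :: real where "offset = 1 / (1 - contraction)"

lemma growth_gt_1: "1 < growth"
  using q_half by (simp add: growth_def)

text \<open>With \<open>growth = 1 + e\<close> and denominators cleared, the upper bound becomes
  \<open>2 * q * e < 1 - 2 * q\<close>, which holds since \<open>e = (1 - 2 * q) / 2\<close> and
  \<open>q < 1 / 2\<close>.\<close>

lemma contraction_bounds: "0 < contraction" "contraction < 1"
proof -
  show "0 < contraction"
    unfolding contraction_def using growth_gt_1 q_pos p_bounds by (intro add_pos_pos) auto
  define e where "e = (1 - 2 * q) / 2"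
  have e: "growth = 1 + e" "0 < e" "2 * e = 1 - 2 * q" using q_half by (auto simp: growth_def e_def)
  have "q * e < (1 / 2) * e" using e q_half by (intro mult_strict_right_mono) auto
  then have "2 * (q * e) < 1 - 2 * q" using e by linarith
  then have "e * (2 * (q * e)) < e * (1 - 2 * q)" using e by (intro mult_strict_left_mono) auto
  then have "(q * growth) * (2 * growth - 1) + p * growth < 2 * growth - 1"
    unfolding e p_eq by (simp add: algebra_simps)
  then have "q * growth + p * growth / (2 * growth - 1) < 1"
    using growth_gt_1 by (simp add: field_simps)
  then show "contraction < 1" by (simp add: contraction_def)
qed

lemma offset_ge_1: "1 \<le> offset"
  using contraction_bounds by (simp add: offset_def field_simps)

text \<open>In the recursion of \<open>bit_avg_consume\<close>, \<open>growth ^ y\<close> acquires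
  the factor \<open>\<kappa> = growth / (2 * growth - 1)\<close>, the solution of
  \<open>growth + \<kappa> = 2 * \<kappa> * growth\<close>. The extra \<open>\<alpha>\<close> pays
  for the lag being cut off at zero.\<close>

lemma bit_avg_consume_le:
  assumes f: "\<And>y. bit_avg y f \<le> \<alpha> * growth ^ y + \<beta>" and \<alpha>: "0 \<le> \<alpha>"
  shows "bit_avg y (\<lambda>a. (f (consume (a @ [True]) True) + f (consume (a @ [False]) False)) / 2)
    \<le> \<alpha> * (growth / (2 * growth - 1)) * growth ^ y + \<alpha> + \<beta>"
proof (induction y)
  case 0
  have "0 \<le> \<alpha> * (growth / (2 * growth - 1))"
    using \<alpha> growth_gt_1 by simp
  then show ?case using f[of 0] unfolding bit_avg_consume(1) by simp
next
  case (Suc y)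
  let ?\<kappa> = "growth / (2 * growth - 1)"
  have eq: "growth + ?\<kappa> = 2 * ?\<kappa> * growth" using growth_gt_1 by (simp add: field_simps)
  have "(\<alpha> * growth ^ Suc y + \<beta> + (\<alpha> * ?\<kappa> * growth ^ y + \<alpha> + \<beta>)) / 2
      = (\<alpha> * (growth + ?\<kappa>) * growth ^ y + \<alpha>) / 2 + \<beta>"
    by (simp add: algebra_simps)
  also have "\<dots> = \<alpha> * ?\<kappa> * growth ^ Suc y + \<alpha> / 2 + \<beta>" unfolding eq by simp
  finally have eq': "(\<alpha> * growth ^ Suc y + \<beta> + (\<alpha> * ?\<kappa> * growth ^ y + \<alpha> + \<beta>)) / 2 =
    \<alpha> * ?\<kappa> * growth ^ Suc y + \<alpha> / 2 + \<beta>" .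
  have "(bit_avg (Suc y) f + bit_avg y (\<lambda>a. (f (consume (a @ [True]) True) + f (consume (a @ [False]) False)) / 2)) / 2
      \<le> (\<alpha> * growth ^ Suc y + \<beta> + (\<alpha> * ?\<kappa> * growth ^ y + \<alpha> + \<beta>)) / 2"
    by (intro divide_right_mono add_mono f Suc.IH) simp
  also note eq'
  finally show ?case unfolding bit_avg_consume(2) using \<alpha> by simp
qed

text \<open>Each bit read multiplies the coefficient of \<open>growth ^ y\<close> by
  \<open>contraction\<close> and adds at most the current coefficient to the constant. Averaging
  over the initial buffer closes the induction, since a uniform buffer stays uniform given its
  length.\<close>

lemma bit_avg_run_le:
  assumes f: "\<And>y. bit_avg y f \<le> \<alpha> * growth ^ y + \<beta>" and \<alpha>: "0 \<le> \<alpha>"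
  shows "bit_avg y (\<lambda>a. bit_avg n (run f a)) \<le> \<alpha> * contraction ^ n * growth ^ y + \<alpha> * offset + \<beta>"
proof -
  define B where "B n = \<beta> + \<alpha> * (\<Sum>i<n. contraction ^ i)" for n
  have bound: "bit_avg y (\<lambda>a. bit_avg n (run f a)) \<le> \<alpha> * contraction ^ n * growth ^ y + B n" for y
  proof (induction n arbitrary: y)
    case (Suc n)
    define g where "g a = bit_avg n (run f a)" for a
    have g: "bit_avg y g \<le> \<alpha> * contraction ^ n * growth ^ y + B n" for y
      using Suc.IH[of y] unfolding g_def .
    have \<alpha>': "0 \<le> \<alpha> * contraction ^ n" using \<alpha> contraction_bounds by simp
    have "bit_avg y (\<lambda>a. bit_avg (Suc n) (run f a)) =
       bit_avg y (\<lambda>a. q * ((g (a @ [True]) + g (a @ [False])) / 2) +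
         p * ((g (consume (a @ [True]) True) + g (consume (a @ [False]) False)) / 2))"
      unfolding g_def by (intro bit_avg_cong) (simp add: bit_avg_add bit_avg_cmult algebra_simps add_divide_distrib)
    also have "\<dots> = q * bit_avg (Suc y) g +
        p * bit_avg y (\<lambda>a. (g (consume (a @ [True]) True) + g (consume (a @ [False]) False)) / 2)"
      unfolding bit_avg_snoc bit_avg_add bit_avg_cmult bit_avg_divide ..
    also have "\<dots> \<le> q * (\<alpha> * contraction ^ n * growth ^ Suc y + B n) +
       p * (\<alpha> * contraction ^ n * (growth / (2 * growth - 1)) * growth ^ y + \<alpha> * contraction ^ n + B n)"
      using q_pos p_bounds \<alpha>' by (intro add_mono mult_left_mono bit_avg_consume_le g) auto
    also have "\<dots> = \<alpha> * contraction ^ n * contraction * growth ^ y + p * (\<alpha> * contraction ^ n) + (p + q) * B n"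
      unfolding contraction_def[of] by (simp add: algebra_simps)
    also have "\<dots> \<le> \<alpha> * contraction ^ Suc n * growth ^ y + B (Suc n)"
      using mult_right_mono[OF p_bounds(4) \<alpha>'] p_bounds(6) by (simp add: B_def algebra_simps)
    finally show ?case .
  qed (use f in \<open>simp add: B_def\<close>)
  have "B n \<le> \<beta> + \<alpha> * offset"
  proof -
    have "(\<Sum>i<n. contraction ^ i) \<le> offset"
      using contraction_bounds unfolding offset_def
      by (subst sum_gp_strict) (auto simp: divide_right_mono)
    then show ?thesis unfolding B_def using \<alpha> by (simp add: mult_left_mono)
  qed
  then show ?thesis using bound[of y] by linarith
qed

definition lag_tail :: "nat \<Rightarrow> bool list \<Rightarrow> bool list \<Rightarrow> real" where
  "lag_tail h = run (\<lambda>a. of_bool (h < length a))"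

lemma lag_tail_nonneg: "0 \<le> lag_tail h a x"
  unfolding lag_tail_def by (rule run_nonneg) simp

text \<open>The expectation over the deletions of \<open>growth ^ h\<close> raised to the number of
  times the lag exceeds \<open>h\<close>, checked at \<open>i\<close> positions spaced by
  \<open>s\<close>, the first before anything is read.\<close>

primrec block_weight :: "nat \<Rightarrow> nat \<Rightarrow> nat \<Rightarrow> bool list \<Rightarrow> bool list \<Rightarrow> real" where
  "block_weight s h 0 a x = 1"
| "block_weight s h (Suc i) a x = (if h < length a then growth ^ h else 1) *
    run (\<lambda>a'. block_weight s h i a' (drop s x)) a (take s x)"

lemma block_weight_nonneg: "0 \<le> block_weight s h i a x"
  using growth_gt_1 by (induction i arbitrary: a x) (auto intro!: run_nonneg mult_nonneg_nonneg)

text \<open>If the lag \<open>y\<close> exceeds \<open>h\<close>, the weight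
  \<open>growth ^ h\<close> is paid for by the contraction over the next block and, in the constant
  term, by \<open>growth ^ y\<close>; otherwise there is no weight. Each block costs only a factor
  \<open>1 + offset\<close>.\<close>

lemma bit_avg_block_weight_le:
  assumes s: "contraction ^ s * growth ^ h \<le> 1"
  shows "bit_avg y (\<lambda>a. bit_avg (i * s) (block_weight s h i a)) \<le> (1 + offset) ^ i * growth ^ y"
proof (induction i arbitrary: y)
  case 0
  then show ?case using growth_gt_1 by (simp add: one_le_power)
next
  case (Suc i)
  define w where "w = (if h < y then growth ^ h else 1)"
  define g where "g a = bit_avg (i * s) (block_weight s h i a)" for a
  define c where "c = (1 + offset) ^ i"
  have c0: "0 \<le> c" using offset_ge_1 by (simp add: c_def)
  have w0: "0 \<le> w" using growth_gt_1 by (simp add: w_def)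
  have "bit_avg y (\<lambda>a. bit_avg (Suc i * s) (block_weight s h (Suc i) a)) =
      bit_avg y (\<lambda>a. w * bit_avg s (run g a))"
  proof (rule bit_avg_cong)
    fix a :: "bool list" assume a: "length a = y"
    have "bit_avg (Suc i * s) (block_weight s h (Suc i) a) =
        bit_avg s (\<lambda>x. bit_avg (i * s) (\<lambda>x'. w * run (\<lambda>a'. block_weight s h i a' x') a x))"
      unfolding mult_Suc bit_avg_append using a by (intro bit_avg_cong) (simp add: w_def)
    also have "\<dots> = w * bit_avg s (run g a)"
      unfolding bit_avg_cmult g_def run_bit_avg ..
    finally show "bit_avg (Suc i * s) (block_weight s h (Suc i) a) = w * bit_avg s (run g a)" .
  qed
  also have "\<dots> \<le> w * (c * contraction ^ s * growth ^ y + c * offset + 0)"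
    unfolding bit_avg_cmult using Suc.IH w0 c0
    by (intro mult_left_mono bit_avg_run_le) (simp_all add: g_def[abs_def] c_def)
  also have "\<dots> = c * ((w * contraction ^ s) * growth ^ y + offset * w)"
    by (simp add: algebra_simps)
  also have "\<dots> \<le> c * (1 * growth ^ y + offset * growth ^ y)"
  proof -
    have "contraction ^ s \<le> 1" using contraction_bounds by (intro power_le_one) auto
    then have "w * contraction ^ s \<le> 1" using s by (simp add: w_def mult.commute)
    moreover have "w \<le> growth ^ y" using growth_gt_1 by (simp add: w_def power_increasing one_le_power)
    ultimately show ?thesis
      using c0 offset_ge_1 growth_gt_1 by (intro mult_left_mono add_mono mult_right_mono) auto
  qed
  also have "\<dots> = (1 + offset) ^ Suc i * growth ^ y" by (simp add: c_def algebra_simps)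
  finally show ?case .
qed

text \<open>The sum of the tail probabilities is the expected number of exceedances, and Jensen's
  inequality takes the exponential inside that expectation block by block.\<close>

lemma exp_lag_tail_le_block_weight:
  "exp (real h * ln growth * (\<Sum>j<i. lag_tail h a (take (j * s) x))) \<le> block_weight s h i a x"
proof (induction i arbitrary: a x)
  case (Suc i)
  let ?c = "real h * ln growth"
  define S where "S a' = (\<Sum>j<i. lag_tail h a' (take (j * s) (drop s x)))" for a'
  have "(\<Sum>j<Suc i. lag_tail h a (take (j * s) x)) =
      of_bool (h < length a) + (\<Sum>j<i. lag_tail h a (take (s + j * s) x))"
    unfolding sum.lessThan_Suc_shift by (simp add: lag_tail_def)
  also have "(\<Sum>j<i. lag_tail h a (take (s + j * s) x)) = run S a (take s x)"
    unfolding take_add S_def lag_tail_def run_append run_sum ..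
  finally have "exp (?c * (\<Sum>j<Suc i. lag_tail h a (take (j * s) x))) =
      exp (?c * of_bool (h < length a)) * exp (run (\<lambda>a'. ?c * S a') a (take s x))"
    by (simp add: run_cmult distrib_left exp_add)
  also have "exp (?c * of_bool (h < length a)) = (if h < length a then growth ^ h else 1)"
    using growth_gt_1 by (simp add: exp_of_nat_mult)
  also have "exp (run (\<lambda>a'. ?c * S a') a (take s x)) \<le> run (\<lambda>a'. exp (?c * S a')) a (take s x)"
    by (rule exp_run_le)
  also have "\<dots> \<le> run (\<lambda>a'. block_weight s h i a' (drop s x)) a (take s x)"
    unfolding S_def by (intro run_mono Suc.IH)
  finally show ?case using growth_gt_1 by (simp add: mult_left_mono)
qed simp

text \<open>Markov's inequality for \<open>block_weight\<close>: if all \<open>L\<close> tails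
  exceed 1/16, at least \<open>L / 16\<close> exceedances are expected, so the weight is
  exponentially large in \<open>h * L\<close>.\<close>

lemma bit_avg_all_lags_large:
  assumes s: "contraction ^ s * growth ^ h \<le> 1"
  shows "bit_avg (k + L * s) (\<lambda>x. of_bool (\<forall>j<L. 1 / 16 < lag_tail h [] (take (k + j * s) x)))
    \<le> (1 + offset) ^ Suc L / exp (real h * ln growth * real L / 16)"
proof -
  define f where "f x = run (\<lambda>a. block_weight s h L a (drop k x)) [] (take k x)" for x
  define g where "g a = bit_avg (L * s) (block_weight s h L a)" for a
  have "bit_avg (k + L * s) f = bit_avg 0 (\<lambda>a. bit_avg k (run g a))"
    unfolding bit_avg_append f_def g_def by (simp add: run_bit_avg) (rule bit_avg_cong, simp add: run_bit_avg)
  also have "\<dots> \<le> (1 + offset) ^ L * contraction ^ k * growth ^ 0 + (1 + offset) ^ L * offset + 0"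
    using bit_avg_block_weight_le[OF s] offset_ge_1 by (intro bit_avg_run_le) (simp_all add: g_def[abs_def])
  also have "\<dots> \<le> (1 + offset) ^ L * 1 + (1 + offset) ^ L * offset"
    using contraction_bounds offset_ge_1 by (simp add: power_le_one mult_left_le)
  finally have avg: "bit_avg (k + L * s) f \<le> (1 + offset) ^ Suc L" by (simp add: algebra_simps)
  have "bit_avg (k + L * s) (\<lambda>x. of_bool (\<forall>j<L. 1 / 16 < lag_tail h [] (take (k + j * s) x)))
      \<le> bit_avg (k + L * s) f / exp (real h * ln growth * real L / 16)"
  proof (rule bit_avg_Markov)
    show "0 \<le> f x" for x unfolding f_def by (intro run_nonneg block_weight_nonneg)
    fix x :: "bool list" assume *: "\<forall>j<L. 1 / 16 < lag_tail h [] (take (k + j * s) x)"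
    define S where "S a = (\<Sum>j<L. lag_tail h a (take (j * s) (drop k x)))" for a
    have "real L / 16 \<le> (\<Sum>j<L. lag_tail h [] (take (k + j * s) x))"
      using sum_mono[of "{..<L}" "\<lambda>_. 1 / 16" "\<lambda>j. lag_tail h [] (take (k + j * s) x)"] * by (simp add: less_imp_le)
    also have "\<dots> = run S [] (take k x)"
      unfolding take_add S_def lag_tail_def run_append run_sum ..
    finally have "real h * ln growth * (real L / 16) \<le> real h * ln growth * run S [] (take k x)"
      using growth_gt_1 by (intro mult_left_mono) auto
    then have "exp (real h * ln growth * (real L / 16)) \<le> exp (real h * ln growth * run S [] (take k x))"
      by simp
    also have "\<dots> = exp (run (\<lambda>a. real h * ln growth * S a) [] (take k x))" by (simp add: run_cmult)
    also have "\<dots> \<le> run (\<lambda>a. exp (real h * ln growth * S a)) [] (take k x)" by (rule exp_run_le)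
    also have "\<dots> \<le> f x"
      unfolding f_def S_def by (intro run_mono exp_lag_tail_le_block_weight)
    finally show "exp (real h * ln growth * real L / 16) \<le> f x" by simp
  qed simp
  also have "\<dots> \<le> (1 + offset) ^ Suc L / exp (real h * ln growth * real L / 16)"
    using avg by (intro divide_right_mono) auto
  finally show ?thesis .
qed

text \<open>Markov's inequality for the moment of \<open>growth\<close> to the power of the lag,
  over the deletions and then over the string; \<open>bit_avg_run_le\<close> bounds this moment
  uniformly in \<open>k\<close>.\<close>

lemma bit_avg_lag_large:
  assumes "0 < \<epsilon>"
  shows "bit_avg k (\<lambda>x. of_bool (\<epsilon> < lag_tail h [] x)) \<le> (1 + offset) / (growth ^ h * \<epsilon>)"
proof -
  have "bit_avg y (\<lambda>a. growth ^ length a) \<le> 1 * growth ^ y + 0" for y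
  proof -
    have "bit_avg y (\<lambda>a. growth ^ length a) = bit_avg y (\<lambda>a. growth ^ y)"
      by (rule bit_avg_cong) simp
    then show ?thesis by simp
  qed
  from bit_avg_run_le[OF this, of 0 k] have "bit_avg k (run (\<lambda>a. growth ^ length a) []) \<le> contraction ^ k + offset"
    by simp
  also have "\<dots> \<le> 1 + offset" using contraction_bounds by (simp add: power_le_one)
  finally have avg: "bit_avg k (run (\<lambda>a. growth ^ length a) []) \<le> 1 + offset" .
  have "bit_avg k (\<lambda>x. of_bool (\<epsilon> < lag_tail h [] x)) \<le>
      bit_avg k (run (\<lambda>a. growth ^ length a) []) / (growth ^ h * \<epsilon>)"
  proof (rule bit_avg_Markov)
    show "0 \<le> run (\<lambda>a. growth ^ length a) [] x" for x using growth_gt_1 by (intro run_nonneg) simp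
    show "0 < growth ^ h * \<epsilon>" using growth_gt_1 assms by simp
    fix x assume "\<epsilon> < lag_tail h [] x"
    then have "growth ^ h * \<epsilon> \<le> growth ^ h * lag_tail h [] x"
      using growth_gt_1 by (intro mult_left_mono) auto
    also have "\<dots> \<le> run (\<lambda>a. growth ^ length a) [] x"
      unfolding lag_tail_def run_cmult[symmetric] using growth_gt_1
      by (intro run_mono) (auto simp: power_increasing)
    finally show "growth ^ h * \<epsilon> \<le> run (\<lambda>a. growth ^ length a) [] x" .
  qed
  also have "\<dots> \<le> (1 + offset) / (growth ^ h * \<epsilon>)"
    using avg growth_gt_1 assms by (intro divide_right_mono) auto
  finally show ?thesis .
qed

end

section \<open>Hitting times of the pattern\<close>

context deletion_channel
begin

text \<open>The probability that a trace of \<open>u\<close> ends before greedy matching has used up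
  the pattern \<open>a\<close>. A retained bit that does not occur in the pattern uses it up at
  once.\<close>

fun miss :: "bool list \<Rightarrow> bool list \<Rightarrow> real" where
  "miss [] u = 0"
| "miss (c # a) [] = 1"
| "miss (c # a) (b # u) = q * miss (c # a) u + p * miss (consume (c # a) b) u"

text \<open>Generating function of the number of bits of \<open>u\<close> that remain when the
  pattern \<open>a\<close> is used up.\<close>
fun hit_gf :: "complex \<Rightarrow> bool list \<Rightarrow> bool list \<Rightarrow> complex" where
  "hit_gf z [] u = z ^ length u"
| "hit_gf z (c # a) [] = 0"
| "hit_gf z (c # a) (b # u) = of_real q * hit_gf z (c # a) u + of_real p * hit_gf z (consume (c # a) b) u"

lemma miss_nonneg: "0 \<le> miss a u"
  using p_bounds q_pos by (induction a u rule: miss.induct) auto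

lemma norm_mix_le:
  fixes x y :: complex
  assumes "norm x \<le> X" "norm y \<le> Y"
  shows "norm (of_real q * x + of_real p * y) \<le> q * X + p * Y"
proof -
  have "norm (of_real q * x + of_real p * y) \<le> norm (of_real q * x) + norm (of_real p * y)"
    by (rule norm_triangle_ineq)
  also have "\<dots> \<le> q * X + p * Y"
    unfolding norm_mult using assms q_pos p_bounds by (intro add_mono mult_mono) auto
  finally show ?thesis .
qed

lemma norm_hit_gf_le:
  assumes "norm z \<le> 1"
  shows "norm (hit_gf z a u) \<le> 1"
proof (induction a u rule: miss.induct)
  case (3 c a b u)
  then have "norm (hit_gf z (c # a) (b # u)) \<le> q * 1 + p * 1"
    unfolding hit_gf.simps by (intro norm_mix_le)
  then show ?case using p_bounds by simp
qed (use assms in \<open>auto simp: norm_power power_le_one\<close>)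

lemma miss_le_lag_tail_aux: "miss a u \<le> lag_tail (length u + length c) (a @ c) u"
proof (induction a u arbitrary: c rule: miss.induct)
  case (3 d a b u)
  have "miss (d # a) u \<le> lag_tail (length u + length (c @ [b])) ((d # a) @ c @ [b]) u"
    by (rule "3.IH"(1))
  moreover have "miss (consume (d # a) b) u
      \<le> lag_tail (length u + length (c @ [b])) (consume ((d # a) @ c @ [b]) b) u"
  proof (cases "b \<in> set (d # a)")
    case True
    then show ?thesis using "3.IH"(2)[of "c @ [b]"] by (simp only: consume_append[OF True])
  next
    case False
    then show ?thesis by (simp only: consume_notin[OF False] miss.simps lag_tail_nonneg)
  qed
  ultimately show ?case
    using q_pos p_bounds unfolding lag_tail_def miss.simps run.simps
    by (intro add_mono mult_left_mono) auto
qed (auto simp: lag_tail_nonneg, simp add: lag_tail_def)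

text \<open>The pattern not yet used up consists of the lagging buffer and the unread part of the
  pattern.\<close>
lemma miss_take_le_lag_tail:
  assumes "r \<le> length u"
  shows "miss (a @ take r u) u \<le> lag_tail (length u - r) a u"
  using assms
proof (induction u arbitrary: a r)
  case Nil
  then show ?case using miss_le_lag_tail_aux[of a "[]" "[]"] by simp
next
  case (Cons b u)
  show ?case
  proof (cases r)
    case 0
    then show ?thesis using miss_le_lag_tail_aux[of a "b # u" "[]"] by simp
  next
    case (Suc r')
    obtain c a' where ca: "a @ b # take r' u = c # a'" by (cases "a @ b # take r' u") auto
    have "consume (a @ b # take r' u) b = consume (a @ [b]) b @ take r' u"
      using consume_append[of b "a @ [b]" "take r' u"] by simp
    then have "miss (a @ take r (b # u)) (b # u) =
        q * miss ((a @ [b]) @ take r' u) u + p * miss (consume (a @ [b]) b @ take r' u) u"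
      using ca by (simp add: Suc)
    also have "\<dots> \<le> q * lag_tail (length u - r') (a @ [b]) u + p * lag_tail (length u - r') (consume (a @ [b]) b) u"
      using Cons.prems Suc q_pos p_bounds by (intro add_mono mult_left_mono Cons.IH) auto
    finally show ?thesis by (simp add: lag_tail_def Suc)
  qed
qed

lemma norm_power_diff_le:
  fixes z :: complex
  assumes z: "norm z \<le> 1" and "d \<le> h"
  shows "norm (z ^ (c + d) - z ^ (c + h)) \<le> real h * norm (1 - z)"
proof -
  have 1: "norm (1 - z ^ j) \<le> real j * norm (1 - z)" for j
  proof (induction j)
    case (Suc j)
    have "1 - z ^ Suc j = (1 - z) + z * (1 - z ^ j)" by (simp add: algebra_simps)
    then have "norm (1 - z ^ Suc j) \<le> norm (1 - z) + norm z * norm (1 - z ^ j)"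
      by (metis norm_triangle_ineq norm_mult)
    also have "\<dots> \<le> norm (1 - z) + 1 * (real j * norm (1 - z))"
      using Suc z by (intro add_left_mono mult_mono) auto
    finally show ?case by (simp add: algebra_simps)
  qed simp
  have "z ^ (c + d) - z ^ (c + h) = z ^ (c + d) * (1 - z ^ (h - d))"
    using assms by (simp add: algebra_simps flip: power_add)
  then have "norm (z ^ (c + d) - z ^ (c + h)) \<le> 1 * (real (h - d) * norm (1 - z))"
    unfolding norm_mult using z 1 by (simp only: norm_mult) (intro mult_mono, auto simp: norm_power power_le_one)
  also have "\<dots> \<le> real h * norm (1 - z)" by (auto intro!: mult_right_mono)
  finally show ?thesis .
qed

text \<open>The form of \<open>a\<close>, preserved while reading, keeps the pattern from being used
  up with more than \<open>h\<close> bits of \<open>u\<close> left. A hit within \<open>u\<close>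
  therefore yields an exponent within \<open>h\<close> of \<open>length v + h\<close>; a miss costs
  at most 2, each term having modulus at most 1.\<close>

lemma hit_gf_near_power:
  assumes z: "norm z \<le> 1" and "a = b @ take (length u - h) u"
  shows "norm (hit_gf z a (u @ v) - z ^ (length v + h)) \<le> real h * norm (1 - z) + 2 * miss a u"
  using assms(2)
proof (induction a u arbitrary: b rule: miss.induct)
  case (1 u)
  then have "length u \<le> h" by (cases u) (auto split: if_splits simp: take_eq_Nil)
  then show ?case using norm_power_diff_le[OF z, of "length u" h "length v"]
    by (simp add: add.commute)
next
  case (2 c a)
  have "norm (hit_gf z (c # a) ([] @ v) - z ^ (length v + h)) \<le> norm (hit_gf z (c # a) ([] @ v)) + norm (z ^ (length v + h))"
    by (rule norm_triangle_ineq4)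
  also have "\<dots> \<le> 1 + 1"
    using z by (intro add_mono norm_hit_gf_le) (auto simp: norm_power power_le_one)
  also have "\<dots> \<le> real h * norm (1 - z) + 2 * miss (c # a) []" by simp
  finally show ?case .
next
  case (3 c a x u)
  let ?t = "z ^ (length v + h)" and ?e = "real h * norm (1 - z)"
  have "(\<exists>b. c # a = b @ take (length u - h) u) \<and> (\<exists>b. consume (c # a) x = b @ take (length u - h) u)"
  proof (cases "h \<le> length u")
    case True
    then have eq: "c # a = (b @ [x]) @ take (length u - h) u"
      using "3.prems" by (simp add: Suc_diff_le)
    have "consume (c # a) x = consume (b @ [x]) x @ take (length u - h) u"
      unfolding eq by (rule consume_append) simp
    with eq show ?thesis by blast
  qed auto
  then have "norm (hit_gf z (c # a) (u @ v) - ?t) \<le> ?e + 2 * miss (c # a) u"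
    "norm (hit_gf z (consume (c # a) x) (u @ v) - ?t) \<le> ?e + 2 * miss (consume (c # a) x) u"
    using "3.IH" by blast+
  then have "norm (of_real q * (hit_gf z (c # a) (u @ v) - ?t) + of_real p * (hit_gf z (consume (c # a) x) (u @ v) - ?t))
    \<le> q * (?e + 2 * miss (c # a) u) + p * (?e + 2 * miss (consume (c # a) x) u)"
    by (rule norm_mix_le)
  also have "\<dots> = (p + q) * ?e + 2 * miss (c # a) (x # u)" by (simp add: algebra_simps)
  also have "\<dots> = ?e + 2 * miss (c # a) (x # u)" by (simp only: p_bounds(6) mult_1)
  also have "of_real q * (hit_gf z (c # a) (u @ v) - ?t) + of_real p * (hit_gf z (consume (c # a) x) (u @ v) - ?t)
      = hit_gf z (c # a) ((x # u) @ v) - of_real (p + q) * ?t"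
    by (simp add: algebra_simps)
  also have "\<dots> = hit_gf z (c # a) ((x # u) @ v) - ?t" by (simp only: p_bounds(6) of_real_1 mult_1)
  finally show ?case .
qed

lemma norm_hit_gf_ge:
  assumes z: "norm z \<le> 1" and k: "k + h \<le> length u"
  shows "norm z ^ (length u - k) - real h * norm (1 - z) - 2 * miss (take k u) (take (k + h) u)
    \<le> norm (hit_gf z (take k u) u)"
proof -
  have "take k u = [] @ take (length (take (k + h) u) - h) (take (k + h) u)"
    using k by (simp add: min_def)
  from hit_gf_near_power[OF z this, of "drop (k + h) u"]
  have "norm (hit_gf z (take k u) u - z ^ (length u - k)) \<le>
      real h * norm (1 - z) + 2 * miss (take k u) (take (k + h) u)"
    using k by simp
  then show ?thesis
    using norm_triangle_ineq3[of "hit_gf z (take k u) u" "z ^ (length u - k)"] by (simp add: norm_power)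
qed

end

section \<open>Generating functions of traces\<close>

primrec bits_gf :: "complex \<Rightarrow> bool list \<Rightarrow> complex" where
  "bits_gf w [] = 0"
| "bits_gf w (b # x) = of_bool b + w * bits_gf w x"

lemma bits_gf_append: "bits_gf w (x @ y) = bits_gf w x + w ^ length x * bits_gf w y"
  by (induction x) (auto simp: algebra_simps)

definition bit_at :: "nat \<Rightarrow> bool list \<Rightarrow> real" where
  "bit_at j x = of_bool (j < length x \<and> x ! j)"

lemma bit_at_bounds: "0 \<le> bit_at j x" "bit_at j x \<le> 1"
  by (auto simp: bit_at_def)

lemma bits_gf_eq_sum:
  "length x \<le> n \<Longrightarrow> bits_gf w x = (\<Sum>j<n. of_real (bit_at j x) * w ^ j)"
proof (induction x arbitrary: n)
  case (Cons b x)
  then obtain n' where n: "n = Suc n'" "length x \<le> n'" by (cases n) auto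
  have "(\<Sum>j<n. of_real (bit_at j (b # x)) * w ^ j) =
      of_bool b + (\<Sum>j<n'. of_real (bit_at j x) * w ^ Suc j)"
    unfolding n(1) sum.lessThan_Suc_shift by (simp add: bit_at_def)
  then show ?case using Cons.IH[OF n(2)] by (simp add: sum_distrib_left mult_ac)
qed (simp add: bit_at_def)

lemma norm_bits_gf_le:
  assumes "norm w < 1"
  shows "norm (bits_gf w x) \<le> 1 / (1 - norm w)"
proof (induction x)
  case (Cons b x)
  have "norm (bits_gf w (b # x)) \<le> norm (of_bool b :: complex) + norm w * norm (bits_gf w x)"
    by (simp add: norm_triangle_le flip: norm_mult)
  also have "\<dots> \<le> 1 + norm w * (1 / (1 - norm w))"
    using Cons by (intro add_mono mult_left_mono) auto
  also have "\<dots> = 1 / (1 - norm w)" using assms by (simp add: field_simps)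
  finally show ?case .
qed (use assms in simp)

text \<open>Reads the trace \<open>T\<close>, matching its bits greedily to the known string \<open>a\<close>, and returns what is
  left of the trace when \<open>a\<close> is used up. The bit of the trace that could not be matched is
  dropped, so that the stopping rule does not look at the bits that are returned.\<close>
fun realign :: "bool list \<Rightarrow> bool list \<Rightarrow> bool list" where
  "realign [] T = T"
| "realign (c # a) [] = []"
| "realign (c # a) (t # T) = realign (consume (c # a) t) T"

lemma length_realign_le: "length (realign a T) \<le> length T"
  by (induction a T rule: realign.induct) auto

lemma finite_set_trace_pmf: "finite (set_pmf (trace_pmf p x))"
proof -
  have "finite (set_pmf (replicate_pmf n (bernoulli_pmf p)))" for n
    unfolding set_replicate_pmf lists_eq_set
    by (rule finite_subset[OF _ finite_lists_length_eq[of "UNIV :: bool set" n]]) auto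
  then show ?thesis by (simp add: trace_pmf_def)
qed

lemma length_set_trace_pmf:
  assumes "T \<in> set_pmf (trace_pmf p x)"
  shows "length T \<le> length x"
proof -
  obtain m where T: "T = map fst (filter snd (zip x m))"
    using assms by (auto simp: trace_pmf_def)
  have "length (filter snd (zip x m)) \<le> length (zip x m)" by (rule length_filter_le)
  then show ?thesis by (simp add: T)
qed

lemma trace_pmf_Nil: "trace_pmf p [] = return_pmf []"
  by (simp add: trace_pmf_def)

lemma trace_pmf_Cons:
  "trace_pmf p (b # x) =
    bernoulli_pmf p \<bind> (\<lambda>r. map_pmf (\<lambda>T. if r then b # T else T) (trace_pmf p x))"
  unfolding trace_pmf_def
  by (simp add: map_bind_pmf bind_map_pmf map_pmf_def bind_assoc_pmf bind_return_pmf if_distrib cong: if_cong)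

lemma integrable_trace_pmf:
  fixes f :: "bool list \<Rightarrow> 'b :: {banach, second_countable_topology}"
  shows "integrable (measure_pmf (trace_pmf p x)) f"
  by (intro integrable_measure_pmf_finite finite_set_trace_pmf)

context deletion_channel
begin

lemma expectation_trace_Cons:
  fixes f :: "bool list \<Rightarrow> 'b :: {banach, second_countable_topology}"
  shows "measure_pmf.expectation (trace_pmf p (b # x)) f =
    q *\<^sub>R measure_pmf.expectation (trace_pmf p x) f +
    p *\<^sub>R measure_pmf.expectation (trace_pmf p x) (\<lambda>T. f (b # T))"
  unfolding trace_pmf_Cons
  using p_bounds p_eq
  by (subst pmf_expectation_bind[of UNIV]) (auto simp: finite_set_trace_pmf UNIV_bool)

definition trace_mean :: "bool list \<Rightarrow> bool list \<Rightarrow> nat \<Rightarrow> real" where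
  "trace_mean a x j = measure_pmf.expectation (trace_pmf p x) (\<lambda>T. bit_at j (realign a T))"

definition trace_gf :: "bool list \<Rightarrow> bool list \<Rightarrow> complex \<Rightarrow> complex" where
  "trace_gf a x w = measure_pmf.expectation (trace_pmf p x) (\<lambda>T. bits_gf w (realign a T))"

lemma trace_mean_bounds: "0 \<le> trace_mean a x j" "trace_mean a x j \<le> 1"
proof -
  show "0 \<le> trace_mean a x j" unfolding trace_mean_def
    by (intro Bochner_Integration.integral_nonneg bit_at_bounds)
  have "trace_mean a x j \<le> measure_pmf.expectation (trace_pmf p x) (\<lambda>_. 1)"
    unfolding trace_mean_def by (intro integral_mono integrable_trace_pmf bit_at_bounds)
  then show "trace_mean a x j \<le> 1" by simp
qed

lemma trace_gf_eq_sum: "trace_gf a x w = (\<Sum>j<length x. of_real (trace_mean a x j) * w ^ j)"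
proof -
  have "trace_gf a x w = measure_pmf.expectation (trace_pmf p x)
      (\<lambda>T. \<Sum>j<length x. of_real (bit_at j (realign a T)) * w ^ j)"
    unfolding trace_gf_def
  proof (intro integral_cong_AE)
    show "AE T in trace_pmf p x. bits_gf w (realign a T) =
      (\<Sum>j<length x. of_real (bit_at j (realign a T)) * w ^ j)"
      by (intro AE_pmfI bits_gf_eq_sum order_trans[OF length_realign_le length_set_trace_pmf])
  qed simp_all
  also have "\<dots> = (\<Sum>j<length x. of_real (trace_mean a x j) * w ^ j)"
    unfolding trace_mean_def
    by (simp add: Bochner_Integration.integral_sum integrable_trace_pmf)
  finally show ?thesis .
qed

lemma norm_trace_gf_le:
  assumes "norm w < 1"
  shows "norm (trace_gf a x w) \<le> 1 / (1 - norm w)"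
proof -
  have "norm (trace_gf a x w) \<le> measure_pmf.expectation (trace_pmf p x) (\<lambda>T. norm (bits_gf w (realign a T)))"
    unfolding trace_gf_def by (rule integral_norm_bound)
  also have "\<dots> \<le> measure_pmf.expectation (trace_pmf p x) (\<lambda>_. 1 / (1 - norm w))"
    by (intro integral_mono integrable_trace_pmf norm_bits_gf_le assms)
  finally show ?thesis by simp
qed

text \<open>The bit at position \<open>k\<close> is retained with probability \<open>p\<close> and
  is then preceded by a binomial number of retained bits, whose generating function is
  \<open>(q + p * w) ^ k\<close>.\<close>

lemma trace_gf_Nil: "trace_gf [] x w = of_real p * bits_gf (of_real q + of_real p * w) x"
proof (induction x)
  case Nil
  then show ?case by (simp add: trace_gf_def trace_pmf_Nil)
next
  case (Cons b x)
  have "trace_gf [] (b # x) w = of_real q * trace_gf [] x w + of_real p * (of_bool b + w * trace_gf [] x w)"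
    unfolding trace_gf_def
    by (simp add: expectation_trace_Cons integrable_trace_pmf scaleR_conv_of_real)
  then show ?case unfolding Cons by (simp add: algebra_simps)
qed

lemma trace_gf_Cons:
  "trace_gf (c # a) (b # x) w =
    of_real q * trace_gf (c # a) x w + of_real p * trace_gf (consume (c # a) b) x w"
  unfolding trace_gf_def by (simp add: expectation_trace_Cons scaleR_conv_of_real)

text \<open>When the pattern is used up inside \<open>u\<close>, what remains is an ordinary trace
  of the rest of \<open>u\<close> followed by \<open>v\<close> or \<open>v'\<close>; the common part
  cancels and the rest of \<open>u\<close> only contributes a power of \<open>z\<close>. A miss
  costs two trivial bounds.\<close>

lemma trace_gf_diff:
  fixes w z :: complex
  assumes w: "norm w < 1" and z: "z = of_real q + of_real p * w"
  shows "norm (trace_gf a (u @ v) w - trace_gf a (u @ v') w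
      - of_real p * hit_gf z a u * (bits_gf z v - bits_gf z v')) \<le> 2 * miss a u / (1 - norm w)"
proof (induction a u rule: miss.induct)
  case (1 u)
  have "bits_gf z (u @ v) - bits_gf z (u @ v') = z ^ length u * (bits_gf z v - bits_gf z v')"
    by (simp add: bits_gf_append algebra_simps)
  then show ?case by (simp add: trace_gf_Nil z[symmetric] flip: right_diff_distrib)
next
  case (2 c a)
  have "norm (trace_gf (c # a) v w - trace_gf (c # a) v' w) \<le> 1 / (1 - norm w) + 1 / (1 - norm w)"
    by (rule order_trans[OF norm_triangle_ineq4 add_mono]) (rule norm_trace_gf_le[OF w])+
  then show ?case by simp
next
  case (3 c a b u)
  let ?D = "\<lambda>a. trace_gf a (u @ v) w - trace_gf a (u @ v') w
      - of_real p * hit_gf z a u * (bits_gf z v - bits_gf z v')"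
  have "trace_gf (c # a) ((b # u) @ v) w - trace_gf (c # a) ((b # u) @ v') w
      - of_real p * hit_gf z (c # a) (b # u) * (bits_gf z v - bits_gf z v')
    = of_real q * ?D (c # a) + of_real p * ?D (consume (c # a) b)"
    by (simp add: trace_gf_Cons algebra_simps)
  also have "norm \<dots> \<le> q * (2 * miss (c # a) u / (1 - norm w)) +
      p * (2 * miss (consume (c # a) b) u / (1 - norm w))"
    by (rule norm_mix_le[OF "3.IH"])
  also have "\<dots> = 2 * miss (c # a) (b # u) / (1 - norm w)"
    by (simp add: add_divide_distrib algebra_simps)
  finally show ?case .
qed

end

section \<open>Separation of the means\<close>

lemma holomorphic_on_bits_gf: "(\<lambda>z. bits_gf z x) holomorphic_on A"
  by (induction x) (auto intro!: holomorphic_intros)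

text \<open>The coefficients of the difference lie in {-1, 0, 1}, which saves the factor 2 of the
  triangle inequality and gives exactly the bound that \<open>large_on_arc\<close> asks for.\<close>

lemma norm_bits_gf_diff_le:
  assumes z: "norm z < 1"
  shows "norm (bits_gf z x - bits_gf z y) \<le> 1 / (1 - norm z)"
proof (induction x y rule: list_induct2')
  case (4 b x c y)
  have "bits_gf z (b # x) - bits_gf z (c # y) = (of_bool b - of_bool c) + z * (bits_gf z x - bits_gf z y)"
    by (simp add: algebra_simps)
  then have "norm (bits_gf z (b # x) - bits_gf z (c # y)) \<le>
      norm (of_bool b - of_bool c :: complex) + norm z * norm (bits_gf z x - bits_gf z y)"
    by (metis norm_triangle_ineq norm_mult)
  also have "\<dots> \<le> 1 + norm z * (1 / (1 - norm z))"
    using 4 by (intro add_mono mult_left_mono) auto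
  also have "\<dots> = 1 / (1 - norm z)" using z by (simp add: field_simps)
  finally show ?case .
next
  case (2 b x)
  then show ?case using norm_bits_gf_le[OF z, of "b # x"] by (simp only: bits_gf.simps(1) diff_0_right)
next
  case (3 c y)
  then show ?case using norm_bits_gf_le[OF z, of "c # y"]
    by (simp only: bits_gf.simps(1) diff_0 norm_minus_cancel)
qed (use z in simp)

lemma bits_gf_diff_large_on_arc:
  fixes r :: real
  assumes "b \<noteq> c" "0 \<le> r" "r < 1" "m > 0"
  obtains \<phi> z where "\<bar>\<phi>\<bar> \<le> pi / real m" "z = of_real r * (cis \<phi> * (1 + cis \<phi>) / 2)"
    "(1 / 8) ^ m \<le> norm (bits_gf z (b # x) - bits_gf z (c # y))"
proof -
  define f where "f z = bits_gf z (b # x) - bits_gf z (c # y)" for z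
  have "f holomorphic_on ball 0 1"
    unfolding f_def by (intro holomorphic_intros holomorphic_on_bits_gf)
  moreover have "norm (f z) \<le> 1 / (1 - norm z)" if "norm z < 1" for z
    unfolding f_def using norm_bits_gf_diff_le[OF that] .
  moreover have "norm (f 0) = 1" using assms(1) by (cases b; cases c) (auto simp: f_def)
  ultimately obtain \<phi> where "\<bar>\<phi>\<bar> \<le> pi / real m"
    "(1 / 8) ^ m \<le> norm (f (of_real r * (cis \<phi> * (1 + cis \<phi>) / 2)))"
    using large_on_arc[of f r m] assms by blast
  then show ?thesis using that unfolding f_def by blast
qed

section \<open>Position of the arc and of its preimage under
  \<open>w \<mapsto> q + p w\<close>\<close>

lemma norm_one_minus_cis_le: "norm (1 - cis t) \<le> \<bar>t\<bar>"
proof -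
  have "(norm (1 - cis t))\<^sup>2 = (1 - cos t)\<^sup>2 + (sin t)\<^sup>2"
    by (simp add: cmod_power2)
  also have "\<dots> = 1 + ((cos t)\<^sup>2 + (sin t)\<^sup>2) - 2 * cos t"
    by (simp only: power2_diff) simp
  also have "\<dots> = 2 - 2 * cos (2 * (t / 2))" by simp
  also have "\<dots> = (2 * sin (t / 2))\<^sup>2" unfolding cos_double_sin by (simp add: power2_eq_square)
  also have "\<dots> \<le> (2 * (t / 2))\<^sup>2"
    using abs_sin_x_le_abs_x[of "t / 2"] unfolding abs_le_square_iff[symmetric] by simp
  finally have "(norm (1 - cis t))\<^sup>2 \<le> \<bar>t\<bar>\<^sup>2" by simp
  then show ?thesis by (rule power2_le_imp_le) simp
qed

context deletion_channel
begin

text \<open>Weighs the two effects on the modulus of the preimage: a decrease from the distance of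
  \<open>z\<close> to the circle, and an increase quadratic in the distance of \<open>z\<close> from
  1.\<close>

lemma norm_preimage_sq:
  fixes z :: complex
  shows "(norm ((z - of_real q) / of_real p))\<^sup>2 = 1 - (1 - (norm z)\<^sup>2) / p + q / p\<^sup>2 * (norm (1 - z))\<^sup>2"
proof -
  have "(norm (z - of_real q))\<^sup>2 = p * ((norm z)\<^sup>2 - q) + q * (norm (1 - z))\<^sup>2"
    unfolding cmod_power2 by (simp add: p_eq power2_eq_square algebra_simps)
  then have "(norm ((z - of_real q) / of_real p))\<^sup>2 = (p * ((norm z)\<^sup>2 - q) + q * (norm (1 - z))\<^sup>2) / p\<^sup>2"
    using p_bounds by (simp add: norm_divide power_divide)
  also have "\<dots> = ((norm z)\<^sup>2 - q) / p + q / p\<^sup>2 * (norm (1 - z))\<^sup>2"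
    using p_bounds by (simp add: power2_eq_square field_simps)
  also have "((norm z)\<^sup>2 - q) / p = 1 - (1 - (norm z)\<^sup>2) / p"
    using p_bounds p_eq by (simp add: field_simps)
  finally show ?thesis .
qed

text \<open>The condition with 576 forces \<open>\<phi>\<^sup>2 \<le> \<rho> / 36\<close> and hence
  \<open>norm (1 - z)\<close> squared at most \<open>\<rho> / 4\<close>. As
  \<open>q / p\<^sup>2 \<le> 2\<close>, the outward push is at most \<open>\<rho> / 2\<close>, half
  of the radial decrease.\<close>

lemma arc_point_bounds:
  fixes \<phi> \<rho> :: real
  assumes \<phi>: "\<bar>\<phi>\<bar> \<le> pi / real m" and \<rho>: "0 < \<rho>" "\<rho> \<le> 1 / 16"
    and m: "576 \<le> (real m)\<^sup>2 * \<rho>" "m > 0"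
    and z: "z = of_real (1 - \<rho>) * (cis \<phi> * (1 + cis \<phi>) / 2)"
  shows "norm z \<le> 1" "1 - 2 * \<rho> \<le> norm z" "norm (1 - z) \<le> \<rho> + 6 / real m"
    "norm ((z - of_real q) / of_real p) \<le> 1 - \<rho> / 4"
proof -
  have \<phi>4: "\<bar>\<phi>\<bar> \<le> 4 / real m"
    using \<phi> pi_less_4 m(2) by (smt (verit) divide_right_mono of_nat_0_le_iff)
  then have "\<phi>\<^sup>2 \<le> (4 / real m)\<^sup>2" by (metis abs_ge_zero power2_abs power_mono)
  also have "\<dots> = 16 / (real m)\<^sup>2" by (simp add: power_divide)
  also have "\<dots> \<le> \<rho> / 36" using m by (simp add: field_simps)
  finally have \<phi>2: "\<phi>\<^sup>2 \<le> \<rho> / 36" .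
  define c where "c = cis \<phi>"
  have c: "norm c = 1" "norm (1 - c) \<le> \<bar>\<phi>\<bar>" using norm_one_minus_cis_le by (auto simp: c_def)
  have c2: "(norm (1 - c))\<^sup>2 \<le> \<phi>\<^sup>2"
    using c(2) power_mono[OF c(2), of 2] by simp
  define s where "s = norm (1 + c) / 2"
  have s2: "s\<^sup>2 = 1 - (norm (1 - c))\<^sup>2 / 4"
    unfolding s_def power_divide norm_one_plus_sq[OF c(1)] by simp
  have s: "0 \<le> s" "s \<le> 1" using norm_triangle_ineq[of 1 c] c by (auto simp: s_def)
  have "s\<^sup>2 \<le> s" using s by (simp add: power2_eq_square mult_left_le)
  then have s_ge: "1 - \<rho> / 144 \<le> s" using s2 c2 \<phi>2 by simp
  have r: "norm (of_real (1 - \<rho>) :: complex) = 1 - \<rho>" unfolding norm_of_real using \<rho> by simp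
  have nz: "norm z = (1 - \<rho>) * s"
    unfolding z c_def[symmetric] s_def norm_mult norm_divide r c(1) by simp
  have "(1 - \<rho>) * s \<le> (1 - \<rho>) * 1" using s \<rho> by (intro mult_left_mono) auto
  then have nz_le: "norm z \<le> 1 - \<rho>" by (simp add: nz)
  then show "norm z \<le> 1" using \<rho> by simp
  have "(1 - \<rho>) * (1 - \<rho> / 144) \<le> norm z" unfolding nz using s_ge \<rho> by (intro mult_left_mono) auto
  moreover have "(1 - \<rho>) * (1 - \<rho> / 144) = 1 - \<rho> - \<rho> / 144 + \<rho> * \<rho> / 144"
    by (simp add: field_simps)
  moreover have "0 \<le> \<rho> * \<rho>" by simp
  ultimately show "1 - 2 * \<rho> \<le> norm z" using \<rho> by linarith
  have "1 - z = of_real \<rho> + of_real (1 - \<rho>) * ((1 - c) * (2 + c) / 2)"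
    unfolding z c_def by (simp add: field_simps)
  then have "norm (1 - z) \<le> norm (of_real \<rho> :: complex) + norm (of_real (1 - \<rho>) * ((1 - c) * (2 + c) / 2))"
    by (metis norm_triangle_ineq)
  also have "\<dots> = \<rho> + (1 - \<rho>) * (norm (1 - c) * (norm (2 + c) / 2))"
    unfolding norm_mult norm_divide r using \<rho> by simp
  also have "\<dots> \<le> \<rho> + 1 * (\<bar>\<phi>\<bar> * (3 / 2))"
    using \<rho> c norm_triangle_ineq[of 2 c] by (intro add_mono mult_mono) auto
  finally have 1: "norm (1 - z) \<le> \<rho> + 3 / 2 * \<bar>\<phi>\<bar>" by simp
  then show "norm (1 - z) \<le> \<rho> + 6 / real m" using \<phi>4 by simp
  have "(norm (1 - z))\<^sup>2 \<le> (\<rho> + 3 / 2 * \<bar>\<phi>\<bar>)\<^sup>2" using 1 by (intro power_mono) auto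
  also have "\<dots> \<le> 2 * \<rho>\<^sup>2 + 9 / 2 * \<phi>\<^sup>2"
    using zero_le_power2[of "\<rho> - 3 / 2 * \<bar>\<phi>\<bar>"] by (simp add: power2_sum power2_diff power_mult_distrib power_divide)
  also have "2 * \<rho>\<^sup>2 \<le> \<rho> / 8" using \<rho> by (simp add: power2_eq_square mult_left_le)
  finally have d2: "(norm (1 - z))\<^sup>2 \<le> \<rho> / 4" using \<phi>2 by simp
  have "(norm z)\<^sup>2 \<le> (1 - \<rho>)\<^sup>2" using nz_le by (intro power_mono) auto
  also have "\<dots> \<le> 1 - \<rho>" using \<rho> by (simp add: power2_eq_square mult_left_le)
  finally have "\<rho> \<le> 1 - (norm z)\<^sup>2" by simp
  also have "\<dots> \<le> (1 - (norm z)\<^sup>2) / p"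
    using calculation \<rho> p_bounds by (simp add: pos_le_divide_eq mult_left_le)
  finally have a1: "\<rho> \<le> (1 - (norm z)\<^sup>2) / p" .
  have "(1 / 2)\<^sup>2 \<le> p\<^sup>2" using p_bounds by (intro power_mono) auto
  then have "q / p\<^sup>2 \<le> 2"
    using q_half p_bounds by (simp add: divide_le_eq power2_eq_square)
  then have a2: "q / p\<^sup>2 * (norm (1 - z))\<^sup>2 \<le> 2 * (\<rho> / 4)"
    using d2 q_pos by (intro mult_mono) auto
  have "(norm ((z - of_real q) / of_real p))\<^sup>2 \<le> 1 - \<rho> / 2"
    unfolding norm_preimage_sq using a1 a2 by linarith
  also have "\<dots> \<le> (1 - \<rho> / 4)\<^sup>2" by (simp add: power2_eq_square algebra_simps)
  finally show "norm ((z - of_real q) / of_real p) \<le> 1 - \<rho> / 4"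
    by (rule power2_le_imp_le) (use \<rho> in simp)
qed

text \<open>The series is split at \<open>J\<close>: the first coefficients are at most
  \<open>\<delta>\<close>, the others at most 1 but damped by
  \<open>(1 - \<rho>) ^ J\<close>.\<close>

lemma norm_trace_gf_diff_le:
  assumes len: "length x = n" "length y = n" and w: "norm w \<le> 1 - \<rho>" "0 < \<rho>" "\<rho> \<le> 1" and \<delta>: "0 \<le> \<delta>"
    and small: "\<And>j. j < J \<Longrightarrow> \<bar>trace_mean a x j - trace_mean a y j\<bar> \<le> \<delta>"
  shows "norm (trace_gf a x w - trace_gf a y w) \<le> (\<delta> + exp (- \<rho> * real J)) / \<rho>"
proof -
  define t where "t = 1 - \<rho>"
  have t: "0 \<le> t" "t < 1" using w by (auto simp: t_def)
  define d where "d j = trace_mean a x j - trace_mean a y j" for j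
  have d1: "\<bar>d j\<bar> \<le> 1" for j
    using trace_mean_bounds[of a x j] trace_mean_bounds[of a y j] by (simp add: d_def abs_le_iff)
  have geo: "(\<Sum>j<n. t ^ j) \<le> 1 / \<rho>" for n
    using t w unfolding t_def by (subst sum_gp_strict) (auto simp: divide_right_mono)
  have "trace_gf a x w - trace_gf a y w = (\<Sum>j<n. of_real (d j) * w ^ j)"
    unfolding trace_gf_eq_sum len d_def by (simp add: sum_subtractf algebra_simps)
  then have "norm (trace_gf a x w - trace_gf a y w) \<le> (\<Sum>j<n. norm (of_real (d j) * w ^ j))"
    by (simp only: norm_sum)
  also have "\<dots> \<le> (\<Sum>j<n. \<bar>d j\<bar> * t ^ j)"
    using w by (intro sum_mono) (auto simp: norm_mult norm_power t_def intro!: mult_left_mono power_mono)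
  \<comment> \<open>Lengthening the sum to \<open>J + n\<close> terms allows the split at
    \<open>J\<close> without comparing \<open>J\<close> with \<open>n\<close>.\<close>
  also have "\<dots> \<le> (\<Sum>j<J + n. \<bar>d j\<bar> * t ^ j)"
    using t by (intro sum_mono2) auto
  also have "\<dots> = (\<Sum>j<J. \<bar>d j\<bar> * t ^ j) + (\<Sum>j<n. \<bar>d (J + j)\<bar> * t ^ (J + j))"
    by (induction n) auto
  also have "\<dots> \<le> (\<Sum>j<J. \<delta> * t ^ j) + (\<Sum>j<n. 1 * t ^ (J + j))"
    using t d1 small by (intro add_mono sum_mono mult_right_mono) (auto simp: d_def)
  also have "\<dots> = \<delta> * (\<Sum>j<J. t ^ j) + t ^ J * (\<Sum>j<n. t ^ j)"
    by (simp add: sum_distrib_left power_add)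
  also have "\<dots> \<le> \<delta> * (1 / \<rho>) + exp (- \<rho> * real J) * (1 / \<rho>)"
  proof (intro add_mono mult_mono geo)
    have "t \<le> exp (- \<rho>)" using exp_ge_add_one_self[of "- \<rho>"] by (simp add: t_def)
    then have "t ^ J \<le> exp (- \<rho>) ^ J" using t by (intro power_mono) auto
    then show "t ^ J \<le> exp (- \<rho> * real J)" by (simp add: exp_of_nat_mult mult.commute flip: exp_of_nat2_mult)
  qed (use t \<delta> in \<open>auto intro: sum_nonneg\<close>)
  finally show ?thesis by (simp add: add_divide_distrib)
qed

text \<open>The two error levels serve different ends. The bound \<open>\<epsilon>\<close> enters
  the comparison of generating functions directly and has to be tiny, while 1/16 only keeps the
  shift factor of order 1. For \<open>k = 0\<close> that factor is exactly a power of
  \<open>z\<close>.\<close>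

definition anchored :: "nat \<Rightarrow> nat \<Rightarrow> real \<Rightarrow> bool list \<Rightarrow> nat \<Rightarrow> bool" where
  "anchored h M \<epsilon> u k \<longleftrightarrow> k \<le> length u \<and> length u \<le> k + M \<and> miss (take k u) u \<le> \<epsilon> \<and>
    (k = 0 \<or> k + h \<le> length u \<and> miss (take k u) (take (k + h) u) \<le> 1 / 16)"

text \<open>Bernoulli's inequality gives 3/4 for the power of \<open>norm z\<close>; the spread over
  \<open>h\<close> positions costs 1/8 and the misses cost twice 1/16.\<close>

lemma anchored_hit_gf_ge:
  assumes anch: "anchored h M \<epsilon> u k"
    and z: "norm z \<le> 1" "1 - 2 * \<rho> \<le> norm z" "real h * norm (1 - z) \<le> 1 / 8"
    and \<rho>: "\<rho> * real M \<le> 1 / 8" "0 \<le> \<rho>" "\<rho> \<le> 1 / 2"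
  shows "1 / 2 \<le> norm (hit_gf z (take k u) u)"
proof -
  have le: "k \<le> length u" "length u - k \<le> M" using anch by (auto simp: anchored_def)
  have "1 + real M * (- 2 * \<rho>) \<le> (1 + - 2 * \<rho>) ^ M"
    using \<rho> by (intro Bernoulli_inequality) auto
  also have "\<dots> \<le> norm z ^ M" using z \<rho> by (intro power_mono) auto
  also have "\<dots> \<le> norm z ^ (length u - k)" using le z by (intro power_decreasing) auto
  finally have "1 + real M * (- 2 * \<rho>) \<le> norm z ^ (length u - k)" .
  moreover have "real M * (- 2 * \<rho>) = - 2 * (\<rho> * real M)" by simp
  ultimately have 34: "3 / 4 \<le> norm z ^ (length u - k)" using \<rho>(1) by linarith
  show ?thesis
  proof (cases "k = 0")
    case True
    then show ?thesis using 34 by (simp add: norm_power)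
  next
    case False
    then have "k + h \<le> length u" "miss (take k u) (take (k + h) u) \<le> 1 / 16"
      using anch by (auto simp: anchored_def)
    then show ?thesis using norm_hit_gf_ge[OF z(1), of k h u] 34 z(3) by linarith
  qed
qed

text \<open>If the first \<open>J\<close> means agreed up to \<open>\<delta>\<close>, the generating
  functions would be close at the preimage \<open>w\<close> of the point \<open>z\<close> given by
  the arc bound. There they differ by at least \<open>(1 / 8) ^ m / 4\<close> up to misses, since
  \<open>p\<close> and the shift factor are both at least 1/2.\<close>

lemma trace_means_separated:
  assumes len: "length x = n" "length y = n" and k: "k < n" "take k x = take k y" "x ! k \<noteq> y ! k"
    and anch: "anchored h M \<epsilon> (take k x) k'"
    and \<rho>: "0 < \<rho>" "\<rho> \<le> 1 / 16" "\<rho> * real M \<le> 1 / 8"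
    and m: "576 \<le> (real m)\<^sup>2 * \<rho>" "m > 0" "real h * (\<rho> + 6 / real m) \<le> 1 / 8"
    and \<delta>: "0 \<le> \<delta>" "(\<delta> + exp (- (\<rho> / 4) * real J) + 2 * \<epsilon>) / (\<rho> / 4) < (1 / 8) ^ m / 4"
  shows "\<exists>j<J. \<delta> < \<bar>trace_mean (take k' (take k x)) x j - trace_mean (take k' (take k x)) y j\<bar>"
proof (rule ccontr)
  assume "\<not> ?thesis"
  then have small: "\<bar>trace_mean (take k' (take k x)) x j - trace_mean (take k' (take k x)) y j\<bar> \<le> \<delta>" if "j < J" for j
    using that by force
  define u where "u = take k x"
  define a where "a = take k' u"
  define v v' where "v = drop k x" and "v' = drop k y"
  have uv: "x = u @ v" "y = u @ v'" by (simp_all add: u_def v_def v'_def) (simp add: k(2))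
  have vs: "v = x ! k # drop (Suc k) x" "v' = y ! k # drop (Suc k) y"
    using k(1) len by (simp_all add: v_def v'_def Cons_nth_drop_Suc)
  have "0 \<le> 1 - \<rho>" "1 - \<rho> < 1" using \<rho> by auto
  from bits_gf_diff_large_on_arc[OF k(3) this m(2), of "drop (Suc k) x" "drop (Suc k) y"]
  obtain \<phi> z where \<phi>: "\<bar>\<phi>\<bar> \<le> pi / real m"
    and z: "z = of_real (1 - \<rho>) * (cis \<phi> * (1 + cis \<phi>) / 2)"
    and big: "(1 / 8) ^ m \<le> norm (bits_gf z v - bits_gf z v')"
    unfolding vs by blast
  note zb = arc_point_bounds[OF \<phi> \<rho>(1,2) m(1,2) z]
  define w where "w = (z - of_real q) / of_real p"
  have w: "norm w \<le> 1 - \<rho> / 4" unfolding w_def by (rule zb)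
  have zw: "z = of_real q + of_real p * w" using p_bounds by (simp add: w_def)
  have "real h * norm (1 - z) \<le> 1 / 8"
    using order_trans[OF mult_left_mono[OF zb(3)] m(3)] by simp
  then have hit: "1 / 2 \<le> norm (hit_gf z a u)"
    unfolding a_def u_def using \<rho> zb by (intro anchored_hit_gf_ge[OF anch]) auto
  have w1: "norm w < 1" using w \<rho> by simp
  have "(1 / 8 :: real) ^ m / 4 = (1 / 2) * (1 / 2) * (1 / 8) ^ m" by simp
  also have "\<dots> \<le> p * norm (hit_gf z a u) * norm (bits_gf z v - bits_gf z v')"
    using p_bounds hit big by (intro mult_mono) auto
  also have "\<dots> = norm (of_real p * hit_gf z a u * (bits_gf z v - bits_gf z v'))"
    using p_bounds by (simp add: norm_mult)
  also have "\<dots> \<le> norm (trace_gf a x w - trace_gf a y w) + 2 * miss a u / (1 - norm w)"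
    using trace_gf_diff[OF w1 zw, of a u v v'] unfolding uv[symmetric]
      norm_minus_commute[of "trace_gf a x w - trace_gf a y w"]
    by (rule order_trans[OF norm_triangle_sub add_left_mono])
  also have "\<dots> \<le> (\<delta> + exp (- (\<rho> / 4) * real J)) / (\<rho> / 4) + 2 * \<epsilon> / (\<rho> / 4)"
  proof (intro add_mono)
    show "norm (trace_gf a x w - trace_gf a y w) \<le> (\<delta> + exp (- (\<rho> / 4) * real J)) / (\<rho> / 4)"
      using len w \<rho> \<delta> small unfolding a_def u_def by (intro norm_trace_gf_diff_le) auto
    have "0 \<le> miss a u" "miss a u \<le> \<epsilon>"
      using miss_nonneg anch unfolding a_def u_def anchored_def by auto
    then show "2 * miss a u / (1 - norm w) \<le> 2 * \<epsilon> / (\<rho> / 4)"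
      using w \<rho> by (intro frac_le) auto
  qed
  also have "\<dots> < (1 / 8) ^ m / 4" using \<delta>(2) by (simp add: add_divide_distrib)
  finally show False by simp
qed

end

section \<open>Decoding from empirical means\<close>

lemma nn_integral_replicate_pmf_prod:
  fixes g :: "'a \<Rightarrow> ennreal"
  assumes "nn_integral (measure_pmf D) g \<le> c"
  shows "nn_integral (measure_pmf (replicate_pmf N D)) (\<lambda>xs. prod_list (map g xs)) \<le> c ^ N"
proof (induction N)
  case (Suc N)
  have "nn_integral (measure_pmf (replicate_pmf (Suc N) D)) (\<lambda>xs. prod_list (map g xs)) =
      nn_integral (measure_pmf D) g *
      nn_integral (measure_pmf (replicate_pmf N D)) (\<lambda>xs. prod_list (map g xs))"
    by (simp add: nn_integral_cmult nn_integral_multc)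
  also have "\<dots> \<le> c * c ^ N" by (intro mult_mono assms Suc) auto
  finally show ?case by simp
qed simp

text \<open>Chernoff's method: the exponential moment factorises over the samples and Hoeffding's
  lemma bounds each factor. A threshold proportional to \<open>length xs\<close> is absorbed sample
  by sample.\<close>

lemma prob_replicate_pmf_sum_ge:
  fixes f :: "'a \<Rightarrow> real"
  assumes f: "\<And>x. 0 \<le> f x" "\<And>x. f x \<le> 1" and \<epsilon>: "0 < \<epsilon>"
  shows "measure_pmf.prob (replicate_pmf N D)
    {xs. \<epsilon> * real (length xs) \<le> (\<Sum>x\<leftarrow>xs. f x - measure_pmf.expectation D f)} \<le> exp (- 2 * real N * \<epsilon>\<^sup>2)"
proof -
  define \<mu> where "\<mu> = measure_pmf.expectation D f"
  interpret interval_bounded_random_variable "measure_pmf D" f 0 1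
    by unfold_locales (use f in auto)
  \<comment> \<open>The minimiser of \<open>l\<^sup>2 / 8 - l * \<epsilon>\<close>, with minimum
    \<open>- 2 * \<epsilon>\<^sup>2\<close>.\<close>
  define l where "l = 4 * \<epsilon>"
  define g where "g x = ennreal (exp (l * (f x - \<mu> - \<epsilon>)))" for x
  have "nn_integral (measure_pmf D) g = ennreal (exp (- l * \<epsilon>)) * nn_integral (measure_pmf D) (\<lambda>x. exp (l * (f x - \<mu>)))"
    unfolding g_def by (simp add: nn_integral_cmult[symmetric] algebra_simps flip: ennreal_mult exp_add)
  also have "\<dots> \<le> ennreal (exp (- l * \<epsilon>)) * ennreal (exp (l\<^sup>2 * (1 - 0)\<^sup>2 / 8))"
    unfolding \<mu>_def using \<epsilon> by (intro mult_left_mono Hoeffdings_lemma_nn_integral) (auto simp: l_def)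
  also have "\<dots> = ennreal (exp (- 2 * \<epsilon>\<^sup>2))"
    by (simp add: l_def power2_eq_square flip: ennreal_mult exp_add)
  finally have g: "nn_integral (measure_pmf D) g \<le> ennreal (exp (- 2 * \<epsilon>\<^sup>2))" .
  have prod: "prod_list (map g xs) = ennreal (exp (l * (\<Sum>x\<leftarrow>xs. f x - \<mu> - \<epsilon>)))" for xs
    by (induction xs) (auto simp: g_def ring_distribs exp_add ennreal_mult)
  have sum: "(\<Sum>x\<leftarrow>xs. f x - \<mu> - \<epsilon>) = (\<Sum>x\<leftarrow>xs. f x - \<mu>) - \<epsilon> * real (length xs)" for xs
    by (induction xs) (auto simp: algebra_simps)
  let ?E = "{xs. \<epsilon> * real (length xs) \<le> (\<Sum>x\<leftarrow>xs. f x - \<mu>)}"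
  have "emeasure (measure_pmf (replicate_pmf N D)) ?E = nn_integral (measure_pmf (replicate_pmf N D)) (indicator ?E)"
    by simp
  also have "\<dots> \<le> nn_integral (measure_pmf (replicate_pmf N D)) (\<lambda>xs. prod_list (map g xs))"
    unfolding prod sum using \<epsilon> by (intro nn_integral_mono) (auto simp: indicator_def l_def)
  also have "\<dots> \<le> ennreal (exp (- 2 * \<epsilon>\<^sup>2)) ^ N" by (rule nn_integral_replicate_pmf_prod[OF g])
  also have "\<dots> = ennreal (exp (- 2 * real N * \<epsilon>\<^sup>2))"
    by (simp add: ennreal_power exp_of_nat_mult[symmetric] mult_ac)
  finally show ?thesis by (simp add: measure_pmf.emeasure_eq_measure \<mu>_def)
qed

lemma prob_replicate_pmf_abs_sum_ge:
  fixes f :: "'a \<Rightarrow> real"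
  assumes f: "\<And>x. 0 \<le> f x" "\<And>x. f x \<le> 1" and \<epsilon>: "0 < \<epsilon>"
  shows "measure_pmf.prob (replicate_pmf N D)
    {xs. \<epsilon> * real (length xs) \<le> \<bar>\<Sum>x\<leftarrow>xs. f x - measure_pmf.expectation D f\<bar>} \<le> 2 * exp (- 2 * real N * \<epsilon>\<^sup>2)"
proof -
  define \<mu> where "\<mu> = measure_pmf.expectation D f"
  have "integrable (measure_pmf D) f"
    using f by (intro measure_pmf.integrable_const_bound[of _ 1]) auto
  then have \<mu>': "measure_pmf.expectation D (\<lambda>x. 1 - f x) = 1 - \<mu>" by (simp add: \<mu>_def)
  have neg: "(\<Sum>x\<leftarrow>xs. (1 - f x) - (1 - \<mu>)) = - (\<Sum>x\<leftarrow>xs. f x - \<mu>)" for xs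
    by (induction xs) auto
  have "measure_pmf.prob (replicate_pmf N D) {xs. \<epsilon> * real (length xs) \<le> \<bar>\<Sum>x\<leftarrow>xs. f x - \<mu>\<bar>} \<le>
      measure_pmf.prob (replicate_pmf N D) ({xs. \<epsilon> * real (length xs) \<le> (\<Sum>x\<leftarrow>xs. f x - \<mu>)} \<union>
        {xs. \<epsilon> * real (length xs) \<le> - (\<Sum>x\<leftarrow>xs. f x - \<mu>)})"
    by (intro measure_pmf.finite_measure_mono) auto
  also have "\<dots> \<le> measure_pmf.prob (replicate_pmf N D) {xs. \<epsilon> * real (length xs) \<le> (\<Sum>x\<leftarrow>xs. f x - \<mu>)} +
      measure_pmf.prob (replicate_pmf N D) {xs. \<epsilon> * real (length xs) \<le> - (\<Sum>x\<leftarrow>xs. f x - \<mu>)}"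
    by (rule measure_Un_le) auto
  also have "\<dots> \<le> exp (- 2 * real N * \<epsilon>\<^sup>2) + exp (- 2 * real N * \<epsilon>\<^sup>2)"
    using prob_replicate_pmf_sum_ge[of f \<epsilon> N D]
      prob_replicate_pmf_sum_ge[of "\<lambda>x. 1 - f x" \<epsilon> N D] f \<epsilon>
    unfolding \<mu>' neg \<mu>_def[symmetric] by (intro add_mono) auto
  finally show ?thesis by (simp add: \<mu>_def)
qed

section \<open>The consistent-candidate decoder\<close>

lemma finite_bit_strings: "finite (bit_strings n)"
  unfolding bit_strings_def using finite_lists_length_eq[of "UNIV :: bool set" n] by simp

lemma bit_strings_nonempty: "bit_strings n \<noteq> {}"
  by (auto simp: bit_strings_def intro: exI[of _ "replicate n False"])

text \<open>The decoder returns any good string all of whose predicted means agree with the empirical ones.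
  The statistic \<open>F u\<close> may depend on the prefix \<open>u\<close> shared by the two candidates it separates.\<close>
lemma reconstruction_from_separated_means:
  fixes D :: "bool list \<Rightarrow> 'a pmf" and F :: "bool list \<Rightarrow> nat \<Rightarrow> 'a \<Rightarrow> real"
  defines "\<mu> x u j \<equiv> measure_pmf.expectation (D x) (F u j)"
  assumes F: "\<And>u j t. 0 \<le> F u j t" "\<And>u j t. F u j t \<le> 1" and \<delta>: "0 < \<delta>"
    and sep: "\<And>x y. x \<in> bit_strings n \<Longrightarrow> y \<in> bit_strings n \<Longrightarrow> good x \<Longrightarrow> x \<noteq> y \<Longrightarrow>
      \<exists>k<n. \<exists>j<J. take k x = take k y \<and> \<delta> < \<bar>\<mu> x (take k x) j - \<mu> y (take k x) j\<bar>"
  shows "\<exists>A. (\<forall>ts. A ts \<in> bit_strings n) \<and>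
    1 - (measure_pmf.prob (pmf_of_set (bit_strings n)) {x. \<not> good x} +
      2 * real n * real J * exp (- real N * \<delta>\<^sup>2 / 2))
    \<le> measure_pmf.prob (do {x \<leftarrow> pmf_of_set (bit_strings n); ts \<leftarrow> replicate_pmf N (D x); return_pmf (x, ts)})
        {(x, ts). A ts = x}"
proof -
  define consistent where "consistent x ts \<longleftrightarrow> (\<forall>k<n. \<forall>j<J.
    \<bar>\<Sum>t\<leftarrow>ts. F (take k x) j t - \<mu> x (take k x) j\<bar> < \<delta> / 2 * real (length ts))" for x ts
  define P where "P ts x \<longleftrightarrow> x \<in> bit_strings n \<and> good x \<and> consistent x ts" for ts x
  \<comment> \<open>The choice is harmless because \<open>P ts\<close> has at most one solution; the
    default only keeps \<open>A\<close> inside \<open>bit_strings n\<close>.\<close>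
  define A where "A ts = (if \<exists>x. P ts x then SOME x. P ts x else replicate n False)" for ts
  have P_A: "P ts (A ts)" if "P ts x" for ts x
    unfolding A_def using that by (auto intro: someI)
  have A_in: "A ts \<in> bit_strings n" for ts
  proof (cases "\<exists>x. P ts x")
    case True
    then show ?thesis using P_A by (auto simp: P_def)
  next
    case False
    then show ?thesis by (simp add: A_def bit_strings_def)
  qed
  have unique: "x = y" if xy: "P ts x" "P ts y" for ts x y
  proof (rule ccontr)
    assume "x \<noteq> y"
    then obtain k j where kj: "k < n" "j < J" "take k x = take k y"
      and \<delta>_less: "\<delta> < \<bar>\<mu> x (take k x) j - \<mu> y (take k x) j\<bar>"
      using sep[of x y] xy unfolding P_def by blast
    \<comment> \<open>The empirical part of \<open>S c\<close> does not depend on \<open>c\<close>,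
      so \<open>S c - S d\<close> compares two means without the samples.\<close>
    define S where "S c = (\<Sum>t\<leftarrow>ts. F (take k x) j t - c)" for c
    have S: "S c - S d = real (length ts) * (d - c)" for c d
      unfolding S_def by (induction ts) (auto simp: algebra_simps)
    have "\<bar>S (\<mu> x (take k x) j)\<bar> < \<delta> / 2 * real (length ts)" "\<bar>S (\<mu> y (take k x) j)\<bar> < \<delta> / 2 * real (length ts)"
      using xy kj unfolding P_def consistent_def S_def by metis+
    then have "\<bar>S (\<mu> x (take k x) j) - S (\<mu> y (take k x) j)\<bar> < \<delta> * real (length ts)" by linarith
    moreover have "\<delta> * real (length ts) \<le> \<bar>\<mu> x (take k x) j - \<mu> y (take k x) j\<bar> * real (length ts)"
      using \<delta>_less by (intro mult_right_mono) auto
    ultimately show False unfolding S by (simp add: abs_mult abs_minus_commute mult.commute)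
  qed
  let ?U = "pmf_of_set (bit_strings n)" and ?R = "\<lambda>x. replicate_pmf N (D x)"
  let ?M = "do {x \<leftarrow> ?U; ts \<leftarrow> ?R x; return_pmf (x, ts)}"
  define \<eta> where "\<eta> = 2 * real n * real J * exp (- real N * \<delta>\<^sup>2 / 2)"
  have inconsistent: "measure_pmf.prob (?R x) {ts. \<not> consistent x ts} \<le> \<eta>" for x
  proof -
    define B where "B k j = {ts. \<delta> / 2 * real (length ts) \<le> \<bar>\<Sum>t\<leftarrow>ts. F (take k x) j t - \<mu> x (take k x) j\<bar>}" for k j
    \<comment> \<open>For a fixed \<open>x\<close> only its own \<open>n\<close> prefixes matter, so
      the union bound has \<open>n * J\<close> terms although \<open>F\<close> is indexed by all
      strings.\<close>
    have "{ts. \<not> consistent x ts} = (\<Union>(k, j)\<in>{..<n} \<times> {..<J}. B k j)"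
      by (auto simp: consistent_def B_def not_less)
    then have "measure_pmf.prob (?R x) {ts. \<not> consistent x ts} \<le>
        (\<Sum>(k, j)\<in>{..<n} \<times> {..<J}. measure_pmf.prob (?R x) (B k j))"
      unfolding case_prod_beta by (simp only:) (rule measure_pmf.finite_measure_subadditive_finite, auto)
    also have "\<dots> \<le> (\<Sum>(k, j)\<in>{..<n} \<times> {..<J}. 2 * exp (- 2 * real N * (\<delta> / 2)\<^sup>2))"
      unfolding B_def \<mu>_def case_prod_beta using F \<delta> by (intro sum_mono prob_replicate_pmf_abs_sum_ge) auto
    also have "\<dots> = \<eta>" by (simp add: \<eta>_def power_divide)
    finally show ?thesis .
  qed
  define Bad where "Bad = {(x, ts). \<not> (good x \<and> consistent x ts)}"
  have \<eta>0: "0 \<le> \<eta>" by (simp add: \<eta>_def)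
  have "emeasure (measure_pmf ?M) Bad = (\<integral>\<^sup>+x. emeasure (measure_pmf (?R x)) {ts. \<not> (good x \<and> consistent x ts)} \<partial>measure_pmf ?U)"
    by (simp add: Bad_def map_pmf_def[symmetric] vimage_def)
  also have "\<dots> \<le> (\<integral>\<^sup>+x. indicator {x. \<not> good x} x + ennreal \<eta> \<partial>measure_pmf ?U)"
  proof (intro nn_integral_mono)
    fix x
    show "emeasure (measure_pmf (?R x)) {ts. \<not> (good x \<and> consistent x ts)} \<le> indicator {x. \<not> good x} x + ennreal \<eta>"
    proof (cases "good x")
      case True
      then show ?thesis using inconsistent[of x] \<eta>0
        by (simp add: measure_pmf.emeasure_eq_measure)
    next
      case False
      then show ?thesis by (simp add: measure_pmf.emeasure_eq_measure le_iff_add)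
    qed
  qed
  also have "\<dots> = ennreal (measure_pmf.prob ?U {x. \<not> good x} + \<eta>)"
    using \<eta>0 by (simp add: nn_integral_add measure_pmf.emeasure_eq_measure ennreal_plus)
  finally have bad: "measure_pmf.prob ?M Bad \<le> measure_pmf.prob ?U {x. \<not> good x} + \<eta>"
    unfolding measure_pmf.emeasure_eq_measure
    by (subst (asm) ennreal_le_iff) (use \<eta>0 in \<open>auto intro: add_nonneg_nonneg\<close>)
  have "1 - measure_pmf.prob ?M Bad = measure_pmf.prob ?M (- Bad)"
    by (simp add: measure_pmf.prob_compl[of Bad ?M, simplified] Compl_eq_Diff_UNIV)
  also have "\<dots> \<le> measure_pmf.prob ?M {(x, ts). A ts = x}"
  proof (rule measure_pmf.finite_measure_mono_AE)
    show "AE z in ?M. z \<in> - Bad \<longrightarrow> z \<in> {(x, ts). A ts = x}"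
    proof (rule AE_pmfI, rule impI)
      fix z assume z: "z \<in> set_pmf ?M" "z \<in> - Bad"
      then obtain x ts where xt: "z = (x, ts)" "x \<in> bit_strings n"
        by (auto simp: set_pmf_of_set[OF bit_strings_nonempty finite_bit_strings])
      then have "P ts x" using z by (auto simp: P_def Bad_def)
      then show "z \<in> {(x, ts). A ts = x}" using unique[OF P_A] xt by auto
    qed
  qed simp
  finally show ?thesis using A_in bad unfolding \<eta>_def by (intro exI[of _ A]) auto
qed

section \<open>Choice of parameters\<close>

lemma sum_bit_strings: "(\<Sum>x\<in>bit_strings n. f x) = 2 ^ n * bit_avg n f"
proof (induction n arbitrary: f)
  case 0
  have "bit_strings 0 = {[]}" by (auto simp: bit_strings_def)
  then show ?case by simp
next
  case (Suc n)
  have "bit_strings (Suc n) = (#) True ` bit_strings n \<union> (#) False ` bit_strings n"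
    by (auto simp: bit_strings_def length_Suc_conv image_iff)
  then have "(\<Sum>x\<in>bit_strings (Suc n). f x) =
      (\<Sum>x\<in>(#) True ` bit_strings n. f x) + (\<Sum>x\<in>(#) False ` bit_strings n. f x)"
    using finite_bit_strings by (simp only:) (rule sum.union_disjoint, auto)
  also have "\<dots> = (\<Sum>x\<in>bit_strings n. f (True # x)) + (\<Sum>x\<in>bit_strings n. f (False # x))"
    by (simp add: sum.reindex)
  finally show ?case by (simp add: Suc algebra_simps)
qed

lemma prob_bit_strings:
  "measure_pmf.prob (pmf_of_set (bit_strings n)) {x. P x} = bit_avg n (\<lambda>x. of_bool (P x))"
proof -
  have card: "real (card (bit_strings n)) = 2 ^ n"
    using sum_bit_strings[of "\<lambda>_. 1" n] by simp
  have "real (card (bit_strings n \<inter> {x. P x})) = (\<Sum>x\<in>bit_strings n. of_bool (P x))"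
    using finite_bit_strings by (simp add: sum_of_bool_eq)
  then show ?thesis
    using card by (simp add: measure_pmf_of_set[OF bit_strings_nonempty finite_bit_strings] sum_bit_strings)
qed

lemma bit_avg_take:
  assumes "k \<le> n"
  shows "bit_avg n (\<lambda>x. f (take k x)) = bit_avg k f"
proof -
  have "bit_avg (k + (n - k)) (\<lambda>x. f (take k x)) = bit_avg k f"
    unfolding bit_avg_append by (subst bit_avg_cong[of k _ f]) auto
  then show ?thesis using assms by simp
qed

context deletion_channel
begin

lemma lag_tail_antimono: "h \<le> h' \<Longrightarrow> lag_tail h' a x \<le> lag_tail h a x"
  unfolding lag_tail_def by (intro run_mono) auto

text \<open>The candidates are \<open>k - M + j * s\<close> for \<open>j < L\<close>; either all
  fail the short-window condition, or the lag at \<open>k\<close> is too often above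
  \<open>M'\<close>. As \<open>M = M' + L * s + h\<close>, every candidate lies at least
  \<open>M'\<close> before \<open>k\<close>, so one tail event covers them all.\<close>

lemma bit_avg_not_anchored_le:
  assumes s: "contraction ^ s * growth ^ h \<le> 1" and \<epsilon>: "0 < \<epsilon>" and M: "M = M' + L * s + h"
  shows "bit_avg k (\<lambda>u. of_bool (\<not> (\<exists>k'. anchored h M \<epsilon> u k'))) \<le>
    (1 + offset) ^ Suc L / exp (real h * ln growth * real L / 16) + (1 + offset) / (growth ^ M' * \<epsilon>)"
proof (cases "k \<le> M")
  \<comment> \<open>A short prefix is anchored at 0, since the empty pattern is never
    missed.\<close>
  case True
  then have "anchored h M \<epsilon> u 0" if "length u = k" for u
    using that \<epsilon> by (simp add: anchored_def)
  then have "bit_avg k (\<lambda>u. of_bool (\<not> (\<exists>k'. anchored h M \<epsilon> u k'))) = bit_avg k (\<lambda>u. 0)"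
    by (intro bit_avg_cong) auto
  also have "\<dots> \<le> (1 + offset) ^ Suc L / exp (real h * ln growth * real L / 16) + (1 + offset) / (growth ^ M' * \<epsilon>)"
    using offset_ge_1 growth_gt_1 \<epsilon> by simp
  finally show ?thesis .
next
  case False
  \<comment> \<open>The lag relevant to a candidate is read \<open>h\<close> positions after it,
    hence the shift by \<open>h\<close>.\<close>
  define k0 where "k0 = k - M + h"
  have k0: "k0 + L * s \<le> k" "k0 = k - M + h" "M \<le> k" using False M by (auto simp: k0_def)
  define P where "P u \<longleftrightarrow> (\<forall>j<L. 1 / 16 < lag_tail h [] (take (k0 + j * s) u))" for u
  have "of_bool (\<not> (\<exists>k'. anchored h M \<epsilon> u k')) \<le> of_bool (P (take (k0 + L * s) u)) + (of_bool (\<epsilon> < lag_tail M' [] u) :: real)"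
    if u: "length u = k" for u
  proof (cases "P (take (k0 + L * s) u) \<or> \<epsilon> < lag_tail M' [] u")
    case False
    then obtain j where j: "j < L" "lag_tail h [] (take (k0 + j * s) (take (k0 + L * s) u)) \<le> 1 / 16"
      by (auto simp: P_def not_less)
    have js: "j * s \<le> L * s" using j by (intro mult_right_mono) auto
    define k' where "k' = k - M + j * s"
    have k': "k0 + j * s = k' + h" "k' + h \<le> k" "k \<le> k' + M" "M' \<le> k - k'"
    proof -
      obtain e where e: "L * s = j * s + e" using js by (auto simp: le_iff_add)
      show "k0 + j * s = k' + h" "k' + h \<le> k" "k \<le> k' + M" "M' \<le> k - k'"
        using k0 M unfolding k'_def e by linarith+
    qed
    have "take (k0 + j * s) (take (k0 + L * s) u) = take (k' + h) u"
      using js by (simp add: k'(1)[symmetric] min_def)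
    then have "lag_tail h [] (take (k' + h) u) \<le> 1 / 16" using j by simp
    moreover have "miss (take k' u) (take (k' + h) u) \<le> lag_tail h [] (take (k' + h) u)"
    proof -
      have "length (take (k' + h) u) = k' + h" using u k' by simp
      from miss_take_le_lag_tail[of k' "take (k' + h) u" "[]", unfolded this]
      show ?thesis by simp
    qed
    moreover have "miss (take k' u) u \<le> lag_tail (k - k') [] u"
      using miss_take_le_lag_tail[of k' u "[]"] u k' by simp
    moreover have "lag_tail (k - k') [] u \<le> lag_tail M' [] u" by (rule lag_tail_antimono[OF k'(4)])
    ultimately have "anchored h M \<epsilon> u k'"
      unfolding anchored_def using u k' False by auto
    then show ?thesis by auto
  qed auto
  then have "bit_avg k (\<lambda>u. of_bool (\<not> (\<exists>k'. anchored h M \<epsilon> u k'))) \<le>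
      bit_avg k (\<lambda>u. of_bool (P (take (k0 + L * s) u)) + of_bool (\<epsilon> < lag_tail M' [] u))"
    by (rule bit_avg_mono)
  also have "\<dots> = bit_avg (k0 + L * s) (\<lambda>u. of_bool (P u)) + bit_avg k (\<lambda>u. of_bool (\<epsilon> < lag_tail M' [] u))"
    unfolding bit_avg_add using k0 by (subst bit_avg_take[of "k0 + L * s" k "\<lambda>u. of_bool (P u)"]) auto
  also have "\<dots> \<le> (1 + offset) ^ Suc L / exp (real h * ln growth * real L / 16) + (1 + offset) / (growth ^ M' * \<epsilon>)"
    unfolding P_def by (intro add_mono bit_avg_all_lags_large[OF s] bit_avg_lag_large[OF \<epsilon>])
  finally show ?thesis .
qed

lemma prob_not_anchored_le:
  assumes b: "\<And>k. bit_avg k (\<lambda>u. of_bool (\<not> (\<exists>k'. anchored h M \<epsilon> u k'))) \<le> b"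
  shows "measure_pmf.prob (pmf_of_set (bit_strings n)) {x. \<not> (\<forall>k<n. \<exists>k'. anchored h M \<epsilon> (take k x) k')} \<le> real n * b"
proof -
  have "{x. \<not> (\<forall>k<n. \<exists>k'. anchored h M \<epsilon> (take k x) k')} = (\<Union>k\<in>{..<n}. {x. \<not> (\<exists>k'. anchored h M \<epsilon> (take k x) k')})"
    by auto
  then have "measure_pmf.prob (pmf_of_set (bit_strings n)) {x. \<not> (\<forall>k<n. \<exists>k'. anchored h M \<epsilon> (take k x) k')} \<le>
      (\<Sum>k<n. measure_pmf.prob (pmf_of_set (bit_strings n)) {x. \<not> (\<exists>k'. anchored h M \<epsilon> (take k x) k')})"
    by (simp only:) (rule measure_pmf.finite_measure_subadditive_finite, auto)
  also have "\<dots> \<le> (\<Sum>k<n. b)"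
  proof (rule sum_mono)
    fix k assume "k \<in> {..<n}"
    then show "measure_pmf.prob (pmf_of_set (bit_strings n)) {x. \<not> (\<exists>k'. anchored h M \<epsilon> (take k x) k')} \<le> b"
      unfolding prob_bit_strings
      using b[of k] bit_avg_take[of k n "\<lambda>u. of_bool (\<not> (\<exists>k'. anchored h M \<epsilon> u k'))"] by simp
  qed
  finally show ?thesis by simp
qed

text \<open>The anchor is chosen from the prefix alone, so two candidates that first differ at
  \<open>k\<close> are compared through the same statistic.\<close>

lemma reconstruction_from_parameters:
  assumes \<rho>: "0 < \<rho>" "\<rho> \<le> 1 / 16" "\<rho> * real M \<le> 1 / 8"
    and m: "576 \<le> (real m)\<^sup>2 * \<rho>" "m > 0" "real h * (\<rho> + 6 / real m) \<le> 1 / 8"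
    and \<delta>: "0 < \<delta>" "(\<delta> + exp (- (\<rho> / 4) * real J) + 2 * \<epsilon>) / (\<rho> / 4) < (1 / 8) ^ m / 4"
    and b: "\<And>k. bit_avg k (\<lambda>u. of_bool (\<not> (\<exists>k'. anchored h M \<epsilon> u k'))) \<le> b"
  shows "\<exists>A. (\<forall>ts. A ts \<in> bit_strings n) \<and>
    1 - (real n * b + 2 * real n * real J * exp (- real N * \<delta>\<^sup>2 / 2))
    \<le> measure_pmf.prob (string_and_traces_pmf p n N) {(x, ts). A ts = x}"
proof -
  define anchor where "anchor u = (SOME k'. anchored h M \<epsilon> u k')" for u
  define F where "F u j T = bit_at j (realign (take (anchor u) u) T)" for u j T
  define good where "good x \<longleftrightarrow> (\<forall>k<n. \<exists>k'. anchored h M \<epsilon> (take k x) k')" for x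
  have mean: "measure_pmf.expectation (trace_pmf p x) (F u j) = trace_mean (take (anchor u) u) x j" for x u j
    unfolding F_def trace_mean_def ..
  have sep: "\<exists>k<n. \<exists>j<J. take k x = take k y \<and> \<delta> <
      \<bar>measure_pmf.expectation (trace_pmf p x) (F (take k x) j) - measure_pmf.expectation (trace_pmf p y) (F (take k x) j)\<bar>"
    if len: "x \<in> bit_strings n" "y \<in> bit_strings n" and good_x: "good x" and neq: "x \<noteq> y" for x y
  proof -
    have len': "length x = n" "length y = n" using len by (auto simp: bit_strings_def)
    define k where "k = (LEAST k. x ! k \<noteq> y ! k)"
    obtain i where i: "i < n" "x ! i \<noteq> y ! i" using neq len' by (auto simp: list_eq_iff_nth_eq)
    have k: "x ! k \<noteq> y ! k" unfolding k_def by (rule LeastI[of _ i]) (rule i)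
    have "k \<le> i" unfolding k_def by (rule Least_le) (rule i)
    then have kn: "k < n" using i by simp
    have "x ! i = y ! i" if "i < k" for i using not_less_Least[OF that[unfolded k_def]] by simp
    then have pre: "take k x = take k y" using kn len' by (intro nth_take_lemma) auto
    have "\<exists>k'. anchored h M \<epsilon> (take k x) k'" using good_x kn unfolding good_def by blast
    then have "anchored h M \<epsilon> (take k x) (anchor (take k x))"
      unfolding anchor_def by (rule someI_ex)
    from trace_means_separated[OF len' kn pre k this \<rho> m less_imp_le[OF \<delta>(1)] \<delta>(2)]
    show ?thesis unfolding mean using kn pre by blast
  qed
  have F: "0 \<le> F u j T" "F u j T \<le> 1" for u j T unfolding F_def by (rule bit_at_bounds)+
  from reconstruction_from_separated_means[where F = F and D = "trace_pmf p" and N = N, OF F \<delta>(1) sep]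
  obtain A where A: "(\<forall>ts. A ts \<in> bit_strings n) \<and>
    1 - (measure_pmf.prob (pmf_of_set (bit_strings n)) {x. \<not> good x} + 2 * real n * real J * exp (- real N * \<delta>\<^sup>2 / 2))
      \<le> measure_pmf.prob (string_and_traces_pmf p n N) {(x, ts). A ts = x}"
    unfolding string_and_traces_pmf_def by (rule exE)
  moreover have "measure_pmf.prob (pmf_of_set (bit_strings n)) {x. \<not> good x} \<le> real n * b"
    unfolding good_def by (rule prob_not_anchored_le[OF b])
  ultimately show ?thesis by (intro exI[of _ A]) auto
qed

end

section \<open>Orders of magnitude of the parameters\<close>

context deletion_channel
begin

text \<open>The scales are \<open>h\<close>, \<open>s\<close> and \<open>m\<close> of order
  \<open>L\<close>, the window \<open>M\<close> of order \<open>L\<^sup>2\<close>,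
  \<open>\<rho>\<close> of order \<open>1 / L\<^sup>2\<close>, \<open>J\<close> of order
  \<open>L ^ 3\<close>, \<open>\<delta> = exp (- O(L))\<close> and
  \<open>\<epsilon> = exp (- L\<^sup>2)\<close>.\<close>

lemma reconstruction_at_scale:
  "\<exists>(L0::nat) (K::nat) (C::nat). \<forall>L n. L0 \<le> L \<longrightarrow> 1 \<le> n \<longrightarrow> real n \<le> exp ((real L)\<^sup>2) \<longrightarrow>
    (\<exists>N. real N \<le> exp (real K * real L) \<and> (\<exists>A. (\<forall>ts. A ts \<in> bit_strings n) \<and>
      1 - real C / real n \<le> measure_pmf.prob (string_and_traces_pmf p n N) {(x, ts). A ts = x}))"
proof -
  define l where "l = ln growth"
  define c where "c = ln (1 + offset)"
  have l: "0 < l" using growth_gt_1 by (simp add: l_def)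
  have c: "0 < c" using offset_ge_1 by (simp add: c_def)
  have ec: "1 + offset = exp c" using offset_ge_1 by (simp add: c_def)
  have el: "growth = exp l" using growth_gt_1 by (simp add: l_def)
  obtain s0 where s0: "contraction ^ s0 < 1 / growth"
    using real_arch_pow_inv[of "1 / growth" contraction] contraction_bounds growth_gt_1 by auto
  \<comment> \<open>\<open>h0\<close> brings the joint failure at the \<open>L\<close> candidates
    down to \<open>exp (- 2 * R\<^sup>2)\<close>. \<open>K1\<close> does so for the tail at
    \<open>M'\<close>; its 3 includes the loss
    \<open>1 / \<epsilon> = exp (R\<^sup>2)\<close>.\<close>
  obtain h0 :: nat where h0: "16 * (2 + 2 * c) / l \<le> real h0" using real_arch_simple by blast
  obtain K1 :: nat where K1: "(3 + c) / l \<le> real K1" using real_arch_simple by blast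
  have h0l: "2 + 2 * c \<le> real h0 * l / 16" using h0 l by (simp add: field_simps)
  have K1l: "3 + c \<le> real K1 * l" using K1 l by (simp add: field_simps)
  have h01: "1 \<le> h0" and K11: "1 \<le> K1" using h0l K1l c by (auto intro!: Suc_leI gr0I)
  define M0 where "M0 = K1 + s0 * h0 + 2 * h0"
  have M0: "2 * h0 \<le> M0" "1 \<le> M0" "2 \<le> M0" using h01 by (auto simp: M0_def)
  \<comment> \<open>With \<open>2 * h0 \<le> M0\<close> this gives
    \<open>6 * h / m \<le> 1 / 1536\<close>; the other part \<open>h * \<rho>\<close> of the spread
    is at most 1/16.\<close>
  define m0 where "m0 = 4608 * M0"
  \<comment> \<open>\<open>K5 + 2\<close> collects the exponents, in units of \<open>R\<close>, that
    \<open>\<delta>\<close> has to beat: \<open>3 * m0\<close> from \<open>(1 / 8) ^ m\<close>, and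
    \<open>128 * M0 + 4\<close> from the factor \<open>384 * M0 * R\<^sup>2\<close>.\<close>
  define K5 where "K5 = 3 * m0 + 128 * M0 + 2"
  show ?thesis
  proof (rule exI[of _ "K5 + 3"], rule exI[of _ "2 * K5 + 9"], rule exI[of _ "2 + 64 * M0 * (K5 + 2)"], intro allI impI)
    fix L n :: nat
    assume L: "K5 + 3 \<le> L" and n: "1 \<le> n" "real n \<le> exp ((real L)\<^sup>2)"
    define R where "R = real L"
    have R: "real K5 + 3 \<le> R" "3 \<le> R" "1 \<le> R" using L by (auto simp: R_def)
    have "R * 1 \<le> R * R" using R by (intro mult_left_mono) auto
    then have R2: "R \<le> R\<^sup>2" "1 \<le> R\<^sup>2" using R unfolding power2_eq_square by linarith+
    define h where "h = h0 * L"
    define s where "s = s0 * h"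
    define M' where "M' = K1 * L\<^sup>2"
    define M where "M = M' + L * s + h"
    define m where "m = m0 * L"
    define \<rho> where "\<rho> = 1 / (8 * real M0 * R\<^sup>2)"
    define \<epsilon> where "\<epsilon> = exp (- R\<^sup>2)"
    \<comment> \<open>Makes \<open>(\<rho> / 4) * J = (K5 + 2) * R\<close>, so the bound for the
      tail beyond \<open>J\<close> equals \<open>\<delta>\<close>.\<close>
    define J where "J = 32 * M0 * (K5 + 2) * L ^ 3"
    define \<delta> where "\<delta> = exp (- ((real K5 + 2) * R))"
    \<comment> \<open>The Hoeffding exponent \<open>N * \<delta>\<^sup>2 / 2\<close> is then at
      least \<open>3 * R\<^sup>2\<close>: two parts turn the factor \<open>n\<close> into
      \<open>1 / n\<close>, the third absorbs \<open>J\<close>.\<close>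
    define N where "N = nat \<lceil>6 * R\<^sup>2 * exp (2 * (real K5 + 2) * R)\<rceil>"
    define b where "b = 2 * exp (- 2 * R\<^sup>2)"
    have M0R: "0 < 8 * real M0 * R\<^sup>2" using M0 R by simp
    have nz: "real M0 \<noteq> 0" "R \<noteq> 0" using M0 R by auto
    have \<rho>0: "0 < \<rho>" unfolding \<rho>_def using M0R by simp
    have "2 * 1 \<le> real M0 * R\<^sup>2" using M0 R2 by (intro mult_mono) auto
    then have \<rho>16: "\<rho> \<le> 1 / 16" unfolding \<rho>_def by (intro divide_left_mono) auto
    have "real M \<le> real M0 * R\<^sup>2"
    proof -
      have "real M = real K1 * R\<^sup>2 + real (s0 * h0) * R\<^sup>2 + real h0 * R"
        by (simp add: M_def M'_def s_def h_def R_def power2_eq_square)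
      also have "\<dots> \<le> real K1 * R\<^sup>2 + real (s0 * h0) * R\<^sup>2 + real (2 * h0) * R\<^sup>2"
        using R2 R by (intro add_left_mono mult_mono) auto
      finally show ?thesis by (simp add: M0_def algebra_simps)
    qed
    then have \<rho>M: "\<rho> * real M \<le> 1 / 8"
      unfolding \<rho>_def using M0R by (simp add: field_simps)
    have mR: "real m = 4608 * real M0 * R" by (simp add: m_def m0_def R_def)
    have "(real m)\<^sup>2 * \<rho> = 4608 * 576 * real M0"
      unfolding mR \<rho>_def using nz by (simp add: power2_eq_square field_simps)
    then have m576: "576 \<le> (real m)\<^sup>2 * \<rho>" using M0 by simp
    have m0: "m > 0" using M0 L by (simp add: m_def m0_def)
    have h\<rho>: "real h * (\<rho> + 6 / real m) \<le> 1 / 8"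
    proof -
      have "real h * (\<rho> + 6 / real m) = (real h0 / real M0) * (1 / (8 * R) + 1 / 768)"
        unfolding mR \<rho>_def h_def using nz by (simp add: R_def[symmetric] power2_eq_square field_simps)
      also have "\<dots> \<le> (1 / 2) * (1 / 8 + 1 / 768)"
        using M0 R by (intro mult_mono add_mono) (auto simp: divide_le_eq)
      also have "\<dots> \<le> 1 / 8" by simp
      finally show ?thesis .
    qed
    have L_exp: "R \<le> exp R" using exp_ge_add_one_self[of R] by linarith
    have RR: "R\<^sup>2 \<le> exp (2 * R)"
      using power_mono[OF L_exp, of 2] R by (simp add: exp_of_nat_mult[of 2, simplified] exp_double)
    have e1: "2 \<le> exp (1 :: real)" using exp_ge_add_one_self[of 1] by simp
    have R2K: "(real K5 + 3) * R \<le> R\<^sup>2" unfolding power2_eq_square using R by (intro mult_right_mono) auto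
    \<comment> \<open>Here \<open>K5 + 3 \<le> L\<close> is needed: \<open>R\<^sup>2\<close> exceeds
      \<open>(K5 + 2) * R\<close> by at least 1, which covers the factor 2.\<close>
    have \<epsilon>\<delta>: "2 * \<epsilon> \<le> \<delta>"
    proof -
      have "2 * \<epsilon> \<le> exp 1 * exp (- R\<^sup>2)" unfolding \<epsilon>_def using e1 by (intro mult_right_mono) auto
      also have "\<dots> = exp (1 - R\<^sup>2)" by (simp flip: exp_add)
      also have "\<dots> \<le> \<delta>" unfolding \<delta>_def using R2K R by (simp add: algebra_simps)
      finally show ?thesis .
    qed
    have J: "real J = 32 * real M0 * (real K5 + 2) * R ^ 3" by (simp add: J_def R_def algebra_simps)
    have J\<delta>: "exp (- (\<rho> / 4) * real J) = \<delta>"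
    proof -
      have "(\<rho> / 4) * real J = (real K5 + 2) * R"
        unfolding \<rho>_def J using nz by (simp add: power2_eq_square power3_eq_cube field_simps)
      then show ?thesis unfolding \<delta>_def by (simp only: mult_minus_left)
    qed
    have small: "(\<delta> + exp (- (\<rho> / 4) * real J) + 2 * \<epsilon>) / (\<rho> / 4) < (1 / 8) ^ m / 4"
    proof -
      have e8: "(1 / 8 :: real) ^ m \<ge> exp (- (3 * real m))"
      proof -
        have "(8 :: real) = 2 ^ 3" by simp
        also have "\<dots> \<le> exp 1 ^ 3" using e1 by (intro power_mono) auto
        also have "\<dots> = exp 3" by (simp flip: exp_of_nat_mult)
        finally have "8 \<le> exp (3 :: real)" .
        then have "exp (- 3) \<le> (1 / 8 :: real)" by (simp add: exp_minus field_simps)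
        then have "exp (- 3 :: real) ^ m \<le> (1 / 8) ^ m" by (intro power_mono) auto
        then show ?thesis by (simp add: mult.commute flip: exp_of_nat_mult)
      qed
      have "0 < real M0" using M0 by simp
      then have "384 * real M0 < 4 * (128 * real M0)" by linarith
      then have "384 * real M0 * R\<^sup>2 < (4 * (128 * real M0)) * exp (2 * R)"
        using RR by (rule mult_less_le_imp_less) (use nz in auto)
      also have "\<dots> \<le> (exp (2 * R) * exp (128 * real M0 * R)) * exp (2 * R)"
      proof (intro mult_right_mono mult_mono)
        have "(2 :: real)\<^sup>2 \<le> exp 1 ^ 2" using e1 by (intro power_mono) auto
        also have "\<dots> = exp 2" by (simp flip: exp_of_nat_mult)
        also have "\<dots> \<le> exp (2 * R)" using R by simp
        finally show "4 \<le> exp (2 * R)" by simp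
        have "128 * real M0 * 1 \<le> 128 * real M0 * R" using R by (intro mult_left_mono) auto
        also have "\<dots> \<le> exp (128 * real M0 * R)" using exp_ge_add_one_self[of "128 * real M0 * R"] by linarith
        finally show "128 * real M0 \<le> exp (128 * real M0 * R)" by simp
      qed auto
      also have "\<dots> = exp (- (3 * real m)) / \<delta>"
      proof -
        have "2 * R + 128 * real M0 * R + 2 * R = - (3 * real m) + (real K5 + 2) * R"
          by (simp add: mR K5_def m0_def algebra_simps)
        then have "exp (2 * R) * exp (128 * real M0 * R) * exp (2 * R) = exp (- (3 * real m) + (real K5 + 2) * R)"
          by (simp only: exp_add[symmetric])
        then show ?thesis
          unfolding \<delta>_def by (simp only: exp_add exp_minus divide_inverse inverse_inverse_eq)
      qed
      finally have "384 * real M0 * R\<^sup>2 < exp (- (3 * real m)) / \<delta>" .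
      then have "384 * real M0 * R\<^sup>2 * \<delta> < (1 / 8) ^ m"
        using e8 by (simp add: \<delta>_def pos_less_divide_eq)
      moreover have "(\<delta> + exp (- (\<rho> / 4) * real J) + 2 * \<epsilon>) / (\<rho> / 4) \<le> (3 * \<delta>) / (\<rho> / 4)"
        using \<epsilon>\<delta> \<rho>0 unfolding J\<delta> by (intro divide_right_mono) auto
      moreover have "(3 * \<delta>) / (\<rho> / 4) = 384 * real M0 * R\<^sup>2 * \<delta> / 4"
        unfolding \<rho>_def using M0R by (simp add: field_simps)
      ultimately show ?thesis by linarith
    qed
    have contr: "contraction ^ s * growth ^ h \<le> 1"
    proof -
      have "contraction ^ s0 * growth \<le> 1" using s0 growth_gt_1 by (simp add: field_simps)
      then have "(contraction ^ s0 * growth) ^ h \<le> 1"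
        using contraction_bounds growth_gt_1 by (intro power_le_one) auto
      then show ?thesis by (simp add: s_def power_mult power_mult_distrib)
    qed
    have b: "bit_avg k (\<lambda>u. of_bool (\<not> (\<exists>k'. anchored h M \<epsilon> u k'))) \<le> b" for k
    proof -
      have "bit_avg k (\<lambda>u. of_bool (\<not> (\<exists>k'. anchored h M \<epsilon> u k'))) \<le>
        (1 + offset) ^ Suc L / exp (real h * ln growth * real L / 16) + (1 + offset) / (growth ^ M' * \<epsilon>)"
        by (rule bit_avg_not_anchored_le[OF contr _ M_def]) (simp add: \<epsilon>_def)
      also have "\<dots> \<le> exp (- 2 * R\<^sup>2) + exp (- 2 * R\<^sup>2)"
      proof (rule add_mono)
        have "(1 + offset) ^ Suc L / exp (real h * ln growth * real L / 16) = exp ((R + 1) * c - R\<^sup>2 * (real h0 * l / 16))"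
          unfolding ec l_def[symmetric] h_def
          by (simp add: exp_diff R_def power2_eq_square mult_ac exp_add ring_distribs flip: exp_of_nat_mult)
        also have "\<dots> \<le> exp (- 2 * R\<^sup>2)"
        proof -
          have "(R + 1) * c \<le> (2 * R\<^sup>2) * c" using R2 c by (intro mult_right_mono) auto
          moreover have "R\<^sup>2 * (2 + 2 * c) \<le> R\<^sup>2 * (real h0 * l / 16)" using h0l by (intro mult_left_mono) auto
          ultimately show ?thesis by (simp add: algebra_simps)
        qed
        finally show "(1 + offset) ^ Suc L / exp (real h * ln growth * real L / 16) \<le> exp (- 2 * R\<^sup>2)" .
        have "(1 + offset) / (growth ^ M' * \<epsilon>) = exp (c - R\<^sup>2 * (real K1 * l) + R\<^sup>2)"
          unfolding ec el \<epsilon>_def M'_def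
          by (simp add: exp_diff exp_add exp_minus R_def divide_inverse mult_ac flip: exp_of_nat_mult)
        also have "\<dots> \<le> exp (- 2 * R\<^sup>2)"
        proof -
          have "R\<^sup>2 * (3 + c) \<le> R\<^sup>2 * (real K1 * l)" using K1l by (intro mult_left_mono) auto
          moreover have "1 * c \<le> R\<^sup>2 * c" using R2 c by (intro mult_right_mono) auto
          ultimately show ?thesis by (simp add: algebra_simps)
        qed
        finally show "(1 + offset) / (growth ^ M' * \<epsilon>) \<le> exp (- 2 * R\<^sup>2)" .
      qed
      finally show ?thesis by (simp add: b_def)
    qed
    have \<delta>0: "0 < \<delta>" by (simp add: \<delta>_def)
    from reconstruction_from_parameters[OF \<rho>0 \<rho>16 \<rho>M m576 m0 h\<rho> \<delta>0 small b, of n N]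
    obtain A where A: "\<And>ts. A ts \<in> bit_strings n" and prob:
      "1 - (real n * b + 2 * real n * real J * exp (- real N * \<delta>\<^sup>2 / 2))
        \<le> measure_pmf.prob (string_and_traces_pmf p n N) {(x, ts). A ts = x}" by blast
    have nexp: "real n * exp (- 2 * R\<^sup>2) \<le> 1 / real n"
    proof -
      have "real n * real n \<le> exp (R\<^sup>2) * exp (R\<^sup>2)" using n by (intro mult_mono) (auto simp: R_def)
      also have "\<dots> = exp (2 * R\<^sup>2)" by (simp flip: exp_add)
      finally show ?thesis using n by (simp add: exp_minus field_simps)
    qed
    have N_ge: "6 * R\<^sup>2 * exp (2 * (real K5 + 2) * R) \<le> real N" unfolding N_def by linarith
    have "3 * R\<^sup>2 \<le> real N * \<delta>\<^sup>2 / 2"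
    proof -
      have "exp (2 * (real K5 + 2) * R) * \<delta>\<^sup>2 = 1"
        by (simp add: \<delta>_def power2_eq_square flip: exp_add)
      then have "6 * R\<^sup>2 = 6 * R\<^sup>2 * exp (2 * (real K5 + 2) * R) * \<delta>\<^sup>2" by simp
      also have "\<dots> \<le> real N * \<delta>\<^sup>2" using N_ge by (intro mult_right_mono) auto
      finally show ?thesis by simp
    qed
    then have "exp (- real N * \<delta>\<^sup>2 / 2) \<le> exp (- 2 * R\<^sup>2) * exp (- R\<^sup>2)" by (simp flip: exp_add)
    then have "2 * real n * real J * exp (- real N * \<delta>\<^sup>2 / 2) \<le>
        2 * real n * real J * (exp (- 2 * R\<^sup>2) * exp (- R\<^sup>2))" by (intro mult_left_mono) auto
    also have "\<dots> = 2 * (real n * exp (- 2 * R\<^sup>2)) * (real J * exp (- R\<^sup>2))" by simp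
    also have "\<dots> \<le> 2 * (1 / real n) * (32 * real M0 * (real K5 + 2))"
    proof (rule mult_mono)
      show "2 * (real n * exp (- 2 * R\<^sup>2)) \<le> 2 * (1 / real n)" using nexp by (rule mult_left_mono) simp
      have "R ^ 3 \<le> exp R ^ 3" using L_exp R by (intro power_mono) auto
      also have "\<dots> = exp (3 * R)" by (simp flip: exp_of_nat_mult)
      also have "\<dots> \<le> exp (R\<^sup>2)" unfolding power2_eq_square using R by (simp add: mult_right_mono)
      finally have "R ^ 3 * exp (- R\<^sup>2) \<le> 1" by (simp add: exp_minus field_simps)
      then have "32 * real M0 * (real K5 + 2) * (R ^ 3 * exp (- R\<^sup>2)) \<le> 32 * real M0 * (real K5 + 2) * 1"
        by (intro mult_left_mono) auto
      then show "real J * exp (- R\<^sup>2) \<le> 32 * real M0 * (real K5 + 2)" unfolding J by (simp only: mult.assoc mult_1_right)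
    qed auto
    finally have err2: "2 * real n * real J * exp (- real N * \<delta>\<^sup>2 / 2) \<le> 64 * real M0 * (real K5 + 2) / real n" by simp
    have err1: "real n * b \<le> 2 / real n" using nexp by (simp add: b_def)
    have "1 - real (2 + 64 * M0 * (K5 + 2)) / real n \<le> measure_pmf.prob (string_and_traces_pmf p n N) {(x, ts). A ts = x}"
    proof -
      have "real (2 + 64 * M0 * (K5 + 2)) / real n = 2 / real n + 64 * real M0 * (real K5 + 2) / real n"
        by (simp add: add_divide_distrib algebra_simps)
      then show ?thesis using prob err1 err2 by linarith
    qed
    \<comment> \<open>The prefactor \<open>7 * R\<^sup>2\<close> is at most
      \<open>exp (5 * R)\<close>, and \<open>2 * (K5 + 2) + 5 = 2 * K5 + 9\<close>.\<close>
    moreover have "real N \<le> exp (real (2 * K5 + 9) * R)"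
    proof -
      have "real N \<le> 6 * R\<^sup>2 * exp (2 * (real K5 + 2) * R) + 1"
        unfolding N_def using of_int_ceiling_le_add_one[of "6 * R\<^sup>2 * exp (2 * (real K5 + 2) * R)"] by simp
      also have "1 \<le> 1 * exp (2 * (real K5 + 2) * R)" using R by simp
      also have "1 * exp (2 * (real K5 + 2) * R) \<le> R\<^sup>2 * exp (2 * (real K5 + 2) * R)"
        using R2 by (intro mult_right_mono) auto
      finally have "real N \<le> 7 * R\<^sup>2 * exp (2 * (real K5 + 2) * R)" by simp
      also have "\<dots> \<le> exp (3 * R) * exp (2 * R) * exp (2 * (real K5 + 2) * R)"
      proof (intro mult_right_mono mult_mono RR)
        have "(7 :: real) \<le> 2 ^ 3" by simp
        also have "\<dots> \<le> exp 1 ^ 3" using e1 by (intro power_mono) auto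
        also have "\<dots> = exp 3" by (simp flip: exp_of_nat_mult)
        also have "\<dots> \<le> exp (3 * R)" using R by simp
        finally show "7 \<le> exp (3 * R)" .
      qed auto
      also have "\<dots> = exp (real (2 * K5 + 9) * R)" by (simp add: algebra_simps flip: exp_add)
      finally show ?thesis .
    qed
    ultimately show "\<exists>N. real N \<le> exp (real (2 * K5 + 9) * real L) \<and> (\<exists>A. (\<forall>ts. A ts \<in> bit_strings n) \<and>
      1 - real (2 + 64 * M0 * (K5 + 2)) / real n \<le> measure_pmf.prob (string_and_traces_pmf p n N) {(x, ts). A ts = x})"
      using A unfolding R_def by blast
  qed
qed

end

theorem theorem1p1:
  fixes p q :: real
  assumes "0 < q" and "q < 1 / 2" and "p = 1 - q"
  shows "\<exists>C::real. \<forall>n::nat. n \<ge> 2 \<longrightarrow>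
    (\<exists>N::nat. real N \<le> exp (C * sqrt (ln (real n))) \<and>
      (\<exists>A :: bool list list \<Rightarrow> bool list.
        (\<forall>traces. length traces = N \<longrightarrow> A traces \<in> bit_strings n) \<and>
        measure_pmf.prob (string_and_traces_pmf p n N) {(x, traces). A traces = x}
          \<ge> 1 - C / real n))"
proof -
  interpret deletion_channel p q by unfold_locales (fact assms)+
  obtain L0 K C0 :: nat where main: "\<And>L n. L0 \<le> L \<Longrightarrow> 1 \<le> n \<Longrightarrow> real n \<le> exp ((real L)\<^sup>2) \<Longrightarrow>
    \<exists>N. real N \<le> exp (real K * real L) \<and> (\<exists>A. (\<forall>ts. A ts \<in> bit_strings n) \<and>
      1 - real C0 / real n \<le> measure_pmf.prob (string_and_traces_pmf p n N) {(x, ts). A ts = x})"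
    using reconstruction_at_scale by blast
  \<comment> \<open>Since \<open>r \<ge> 1 / 2\<close> below,
    \<open>L0 + r + 1 \<le> (2 * L0 + 3) * r\<close>, which turns the bound in \<open>L\<close> into
    one in \<open>r\<close>. Adding \<open>C0\<close> lets one constant serve both
    estimates.\<close>
  define C where "C = real K * (2 * real L0 + 3) + real C0"
  show ?thesis
  proof (intro exI[of _ C] allI impI)
    fix n :: nat assume n: "2 \<le> n"
    define r where "r = sqrt (ln (real n))"
    \<comment> \<open>Adding \<open>L0\<close> makes the scale admissible for every
      \<open>n\<close>, so small \<open>n\<close> need no separate treatment.\<close>
    define L where "L = L0 + nat \<lceil>r\<rceil>"
    have "1 / 2 \<le> ln (2 :: real)" using ln2_ge_two_thirds by simp
    also have "\<dots> \<le> ln (real n)" using n by simp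
    finally have ln: "1 / 4 \<le> ln (real n)" by simp
    have r: "1 / 2 \<le> r" unfolding r_def using real_sqrt_le_mono[OF ln] by (simp add: real_sqrt_divide)
    have rL: "r \<le> real L" unfolding L_def by linarith
    have "ln (real n) = r\<^sup>2" unfolding r_def using ln by simp
    also have "\<dots> \<le> (real L)\<^sup>2" using rL r by (intro power_mono) auto
    finally have "exp (ln (real n)) \<le> exp ((real L)\<^sup>2)" by (simp only: exp_le_cancel_iff)
    then have "real n \<le> exp ((real L)\<^sup>2)" using n by simp
    then obtain N A where N: "real N \<le> exp (real K * real L)" and A: "\<And>ts. A ts \<in> bit_strings n"
      and prob: "1 - real C0 / real n \<le> measure_pmf.prob (string_and_traces_pmf p n N) {(x, ts). A ts = x}"
      using main[of L n] n unfolding L_def by auto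
    have "real L \<le> real L0 + r + 1" unfolding L_def using r by linarith
    also have "\<dots> \<le> (2 * real L0 + 3) * r"
      using mult_left_mono[OF r, of "2 * real L0 + 2"] by (simp add: algebra_simps)
    finally have "real K * real L \<le> real K * ((2 * real L0 + 3) * r)" by (intro mult_left_mono) auto
    also have "\<dots> \<le> C * r" using r by (simp add: C_def algebra_simps)
    finally have "real N \<le> exp (C * r)" using N by (meson exp_le_cancel_iff order_trans)
    moreover have "real C0 / real n \<le> C / real n" by (intro divide_right_mono) (auto simp: C_def)
    ultimately show "\<exists>N. real N \<le> exp (C * sqrt (ln (real n))) \<and>
      (\<exists>A. (\<forall>traces. length traces = N \<longrightarrow> A traces \<in> bit_strings n) \<and>
        1 - C / real n \<le> measure_pmf.prob (string_and_traces_pmf p n N) {(x, traces). A traces = x})"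
      using A prob unfolding r_def by (intro exI[of _ N] conjI exI[of _ A]) auto
  qed
qed

end
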